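(* (i) Let $1<p<\infty$ and $1/p'=1-1/p$. Then $$RH_p=\{w \text{ weight}: ind\{\phi_{w,Q,1/p',p}\}_Q>0\}=\{w\text{ weight}: ind\{\phi_{w,Q}\}_Q>1/p'\}.$$ (ii) $$RH=\{w\text{ weight}: ind\{\phi_{w,Q}\}_Q>0\}.$$ (iii) $$RH=RH_{LLogL}.$$
   Context: A weight is a positive locally integrable function on $\mathbb{R}^n$. All cubes $Q\subset\mathbb{R}^n$ have sides parallel to the coordinate axes; $|Q|$ is Lebesgue measure, and $f^*$ denotes the nonincreasing rearrangement of $f$. For $1<p<\infty$, $RH_p$ is the class of weights $w$ for which there is $C>0$ such that for all cubes $Q$, $\left(\frac1{|Q|}\int_Q w^p\,dx\right)^{1/p}\le C\frac1{|Q|}\int_Q w\,dx$. Set $RH=\bigcup_{p>1}RH_p$. $RH_{LLogL}$ is the class of weights $w$ for which there is $C>0$ such that for all cubes $Q$, $\|w\|_{L(LogL)(Q,dx/|Q|)}\le C\frac1{|Q|}\int_Q w\,dx$, where $\|f\|_{L(LogL)(Q,dx/|Q|)}=\inf\{r>0:\frac1{|Q|}\int_Q\frac{|f(y)|}{r}\log\left(e+\frac{|f(y)|}{r}\right)dy\le1\}$. For a weight $w$, a cube $Q$ and $0<s<|Q|$, let $\phi_{w,Q}(s)=K(s,w\chi_Q;L^1(Q),L^\infty(Q))=\int_0^s(w\chi_Q)^*(u)\,du$, where $K$ is the Peetre $K$-functional. For $\beta\in[0,1)$, $q\ge1$ let $\phi_{w,Q,\beta,q}(s)=[s^{-\beta}\phi_{w,Q}(s)]^q$;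 so $\phi_{w,Q,0,1}=\phi_{w,Q}$. A non-negative function $\phi$ on an interval $(0,l)$ is almost increasing (a.i.) if there is $C\ge1$ (the constant of almost increase) with $\phi(s)\le C\phi(t)$ for all $s\le t$ in $(0,l)$. The index is $$ind\{\phi_{w,Q,\beta,q}\}_Q=\sup\{\delta\ge0:\exists\gamma\in(0,1)\text{ such that for all cubes }Q,\ \phi_{w,Q,\beta,q}(s)s^{-\delta}\text{ is a.i. on }(0,\gamma|Q|)\text{ with constant of a.i. independent of }Q\},$$ with $\sup\emptyset:=0$. *)

theory Defs
  imports "HOL-Analysis.Analysis"
begin

definition cubes :: "(real ^ 'n) set set" where
  "cubes = {cbox a b | a b. \<exists>l>0. \<forall>i. b $ i = a $ i + l}"

(* Elements of L^1_loc are only determined almost everywhere, so positivity is required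
   almost everywhere; all the notions below are insensitive to null sets. *)
definition weights :: "(real ^ 'n \<Rightarrow> real) set" where
  "weights = {w. (AE x in lebesgue. 0 < w x) \<and>
                 (\<forall>K. compact K \<longrightarrow> set_integrable lebesgue K w)}"

definition avg :: "(real ^ 'n) set \<Rightarrow> (real ^ 'n \<Rightarrow> real) \<Rightarrow> real" where
  "avg Q f = (LINT x:Q|lebesgue. f x) / measure lebesgue Q"

(* The Bochner integral of a non-integrable function is 0, so finiteness of the
   left-hand side is demanded explicitly. *)
definition RHp :: "real \<Rightarrow> (real ^ 'n \<Rightarrow> real) set" where
  "RHp p = {w \<in> weights. \<exists>C>0. \<forall>Q\<in>cubes.
      set_integrable lebesgue Q (\<lambda>x. w x powr p) \<and>
      (avg Q (\<lambda>x. w x powr p)) powr (1 / p) \<le> C * avg Q w}"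

definition RH :: "(real ^ 'n \<Rightarrow> real) set" where
  "RH = (\<Union>p\<in>{1<..}. RHp p)"

(* The value is infinite if no r is admissible. *)
definition LLogL_norm :: "(real ^ 'n) set \<Rightarrow> (real ^ 'n \<Rightarrow> real) \<Rightarrow> ennreal" where
  "LLogL_norm Q f = Inf (ennreal ` {r. 0 < r \<and>
      (\<integral>\<^sup>+y\<in>Q. ennreal (\<bar>f y\<bar> / r * ln (exp 1 + \<bar>f y\<bar> / r)) \<partial>lebesgue)
        / emeasure lebesgue Q \<le> 1})"

definition RH_LLogL :: "(real ^ 'n \<Rightarrow> real) set" where
  "RH_LLogL = {w \<in> weights. \<exists>C>0. \<forall>Q\<in>cubes. LLogL_norm Q w \<le> ennreal (C * avg Q w)}"

(* The nonincreasing rearrangement f^*(u), meaningful for u > 0 and integrable f. *)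
definition rearrangement :: "(real ^ 'n \<Rightarrow> real) \<Rightarrow> real \<Rightarrow> real" where
  "rearrangement f u = Inf {t. 0 \<le> t \<and> emeasure lebesgue {x. t < \<bar>f x\<bar>} \<le> ennreal u}"

(* K(s, w \<chi>_Q; L^1(Q), L^\<infinity>(Q)), in the form of the integral of the rearrangement. *)
definition phi :: "(real ^ 'n \<Rightarrow> real) \<Rightarrow> (real ^ 'n) set \<Rightarrow> real \<Rightarrow> real" where
  "phi w Q s = (LINT u:{0<..<s}|lborel. rearrangement (\<lambda>x. w x * indicator Q x) u)"

definition phi_wt ::
  "(real ^ 'n \<Rightarrow> real) \<Rightarrow> real \<Rightarrow> real \<Rightarrow> (real ^ 'n) set \<Rightarrow> real \<Rightarrow> real" where
  "phi_wt w \<beta> q Q s = (s powr (- \<beta>) * phi w Q s) powr q"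

definition almost_increasing :: "real \<Rightarrow> real \<Rightarrow> (real \<Rightarrow> real) \<Rightarrow> bool" where
  "almost_increasing C l \<phi> \<longleftrightarrow> 1 \<le> C \<and> (\<forall>s\<in>{0<..<l}. 0 \<le> \<phi> s) \<and>
     (\<forall>s\<in>{0<..<l}. \<forall>t\<in>{0<..<l}. s \<le> t \<longrightarrow> \<phi> s \<le> C * \<phi> t)"

(* Taken in ennreal, where Sup {} = 0. *)
definition ind :: "((real ^ 'n) set \<Rightarrow> real \<Rightarrow> real) \<Rightarrow> ennreal" where
  "ind \<Phi> = Sup (ennreal ` {\<delta>. 0 \<le> \<delta> \<and> (\<exists>\<gamma>\<in>{0<..<1}. \<exists>C. \<forall>Q\<in>cubes.
      almost_increasing C (\<gamma> * measure lebesgue Q) (\<lambda>s. \<Phi> Q s * s powr (- \<delta>)))})"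

end

theory Submission imports Defs begin

text \<open>
  Fix a weight \<open>w\<close> and a cube \<open>Q\<close> of measure \<open>L\<close>. Let \<open>W\<close> be the rearrangement of
  \<open>w \<chi>\<^sub>Q\<close>, so that \<open>\<phi>(s) = \<integral>\<^sub>0\<^sup>s W\<close>, and for \<open>0 < t \<le> L\<close> put \<open>\<lambda> = \<phi>(t)/t\<close>.

  The one geometric input is a Calderon-Zygmund decomposition of \<open>Q\<close> at height \<open>2\<lambda>\<close> (lemma
  \<open>calderon_zygmund\<close>). The selected dyadic cubes have averages of \<open>w\<close> comparable to \<open>\<lambda>\<close>, and
  \<open>w \<le> 2\<lambda>\<close> almost everywhere off their union. The union has measure at most \<open>t\<close>: the average of
  \<open>w\<close> over any subset of \<open>Q\<close> of measure more than \<open>t\<close> is at most \<open>\<lambda>\<close>, because \<open>\<phi>(s)/s\<close> is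
  nonincreasing. Hence any bound \<open>\<integral>\<^sub>P F(w) \<le> c |P|\<close> on cubes with average of order \<open>\<lambda>\<close>
  turns into the one-dimensional bound \<open>\<integral>\<^bsub>{W > 2\<lambda>}\<^esub> F(W) \<le> c t\<close> (lemma \<open>level_set_bound\<close>). It is used
  twice.

  \<^item> For \<open>w \<in> RH\<^sub>p\<close> take \<open>F(v) = v\<^sup>p\<close>. With \<open>\<Phi>(t) = \<integral>\<^sub>0\<^sup>t W\<^sup>p\<close> this gives the reverse of
    Jensen's inequality, \<open>\<Phi>(t) \<le> K t\<^bsup>1-p\<^esup> \<phi>(t)\<^sup>p\<close>. Comparing it with Jensen's inequality itself on
    \<open>(0, \<epsilon>t)\<close> and on \<open>(\<epsilon>t, t)\<close> shows that a fixed fraction of \<open>\<Phi>(t)\<close> lives on \<open>(\<epsilon>t, t)\<close>, that is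
    \<open>\<Phi>(\<epsilon>t) \<le> \<eta> \<Phi>(t)\<close> with \<open>\<eta> < 1\<close> (\<open>reverse_jensen_decay\<close>). Iterating, \<open>\<Phi>\<close> and therefore the
    comparable function \<open>(s\<^bsup>-1/p'\<^esup> \<phi>(s))\<^sup>p\<close> decay like a positive power (\<open>RHp_power_decay\<close>). This
    contains Gehring's self-improvement of reverse Hoelder inequalities.

  \<^item> For \<open>w \<in> RH\<^bsub>LLogL\<^esub>\<close> take \<open>F(v) = (v/R) log(e + v/R)\<close> with \<open>R\<close> of order \<open>\<lambda>\<close>. On
    \<open>{W > M\<lambda>}\<close> the logarithm is large when \<open>M\<close> is, so that part of \<open>\<phi>(t)\<close> is small and
    \<open>\<phi>(\<theta>t) \<le> \<phi>(t)/2\<close> for a fixed \<open>\<theta>\<close> (\<open>LLogL_decay\<close>). Iterating, \<open>\<phi>\<close> decays like a positive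
    power.

  In the opposite direction, if \<open>\<phi>(s) s\<^bsup>-\<delta>\<^esup>\<close> is almost increasing with \<open>\<delta> > 1/p'\<close>, then
  \<open>W(s) \<le> \<phi>(s)/s\<close> is dominated by a multiple of \<open>s\<^bsup>\<delta>-1\<^esup>\<close> near \<open>0\<close>, a power that lies in \<open>L\<^sup>p\<close>, and
  integrating it gives the \<open>RH\<^sub>p\<close> inequality (\<open>RHp_of_decay\<close>). Finally, \<open>RH\<^sub>p\<close> implies the
  \<open>L log L\<close> condition because \<open>x log(e + x)\<close> is bounded by a combination of \<open>x\<close> and \<open>x\<^sup>p\<close>.
\<close>

section \<open>The nonincreasing rearrangement\<close>

text \<open>
  This rule rewrites the Lebesgue measure of a set to the Borel measure of its main part, where no
  fact about the set itself applies any more.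
\<close>

declare emeasure_completion [simp del]

text \<open>
  The infimum that defines \<open>f\<^sup>*(u)\<close> is over a closed half-line, because the distribution function
  of \<open>f\<close> is right-continuous; it is nonempty by Markov's inequality. Everything else about \<open>f\<^sup>*\<close>
  follows from this equivalence.
\<close>

lemma rearrangement_gt_iff:
  fixes f :: "real ^ 'n \<Rightarrow> real"
  assumes f: "integrable lebesgue f" and u: "0 < u" and t: "0 \<le> t"
  shows "t < rearrangement f u \<longleftrightarrow> ennreal u < emeasure lebesgue {x. t < \<bar>f x\<bar>}"
proof -
  note [measurable] = borel_measurable_integrable[OF f]
  have meas [measurable]: "{x. c < \<bar>f x\<bar>} \<in> sets lebesgue" for c
  proof -
    have "{x \<in> space lebesgue. c < \<bar>f x\<bar>} \<in> sets lebesgue" by measurable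
    then show ?thesis by simp
  qed
  define S where "S = {t. 0 \<le> t \<and> emeasure lebesgue {x. t < \<bar>f x\<bar>} \<le> ennreal u}"
  have W: "rearrangement f u = Inf S"
    by (simp add: rearrangement_def S_def)
  have bdd: "bdd_below S"
    by (rule bdd_belowI[of _ 0]) (auto simp: S_def)
  have ne: "S \<noteq> {}"
  proof -
    obtain I where I: "(\<integral>\<^sup>+x. norm (f x) \<partial>lebesgue) = ennreal I" "0 \<le> I"
      using f unfolding integrable_iff_bounded by (metis ennreal_cases infinity_ennreal_def less_irrefl)
    define T where "T = I / u + 1"
    have T: "T > 0" using I u by (auto simp: T_def add_nonneg_pos)
    have "emeasure lebesgue {x. T < \<bar>f x\<bar>} \<le> (\<integral>\<^sup>+x. ennreal (1 / T) * norm (f x) \<partial>lebesgue)"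
    proof -
      have "emeasure lebesgue {x. T < \<bar>f x\<bar>} = (\<integral>\<^sup>+x. indicator {x. T < \<bar>f x\<bar>} x \<partial>lebesgue)"
        by (rule nn_integral_indicator[symmetric]) (rule meas)
      also have "\<dots> \<le> (\<integral>\<^sup>+x. ennreal (1 / T) * norm (f x) \<partial>lebesgue)"
      proof (rule nn_integral_mono)
        fix x
        show "indicator {x. T < \<bar>f x\<bar>} x \<le> ennreal (1 / T) * ennreal (norm (f x))"
        proof (cases "T < \<bar>f x\<bar>")
          case True
          then have "1 \<le> 1 / T * norm (f x)" using T by (simp add: field_simps)
          then have "ennreal 1 \<le> ennreal (1 / T * norm (f x))" by (rule ennreal_leI)
          also have "\<dots> = ennreal (1 / T) * ennreal (norm (f x))"
            using T by (intro ennreal_mult) auto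
          finally show ?thesis by (simp add: indicator_def)
        qed simp
      qed
      finally show ?thesis .
    qed
    also have "\<dots> = ennreal (I / T)"
      using I T by (subst nn_integral_cmult) (auto simp: ennreal_mult[symmetric])
    also have "\<dots> \<le> ennreal u"
    proof (rule ennreal_leI)
      have "I \<le> u * T" using u by (simp add: T_def field_simps)
      then show "I / T \<le> u" using T by (simp add: field_simps)
    qed
    finally show ?thesis using T by (auto simp: S_def intro!: exI[of _ T])
  qed
  show ?thesis
  proof
    assume "t < rearrangement f u"
    then have "t \<notin> S" using cInf_lower[OF _ bdd, of t] W by auto
    then show "ennreal u < emeasure lebesgue {x. t < \<bar>f x\<bar>}"
      using t by (auto simp: S_def not_le)
  next
    assume *: "ennreal u < emeasure lebesgue {x. t < \<bar>f x\<bar>}"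
    have eq: "{x. t < \<bar>f x\<bar>} = (\<Union>n. {x. t + 1 / real (Suc n) < \<bar>f x\<bar>})"
    proof (intro set_eqI iffI)
      fix x assume "x \<in> {x. t < \<bar>f x\<bar>}"
      then have "0 < \<bar>f x\<bar> - t" by simp
      then obtain n where "inverse (real (Suc n)) < \<bar>f x\<bar> - t" by (metis reals_Archimedean)
      then show "x \<in> (\<Union>n. {x. t + 1 / real (Suc n) < \<bar>f x\<bar>})"
        by (intro UN_I[of n] CollectI) (simp_all add: inverse_eq_divide)
    next
      fix x assume "x \<in> (\<Union>n. {x. t + 1 / real (Suc n) < \<bar>f x\<bar>})"
      then obtain n where "t + 1 / real (Suc n) < \<bar>f x\<bar>" by blast
      moreover have "0 < 1 / real (Suc n)" by simp
      ultimately have "t < \<bar>f x\<bar>" by linarith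
      then show "x \<in> {x. t < \<bar>f x\<bar>}" by simp
    qed
    have "(SUP n. emeasure lebesgue {x. t + 1 / real (Suc n) < \<bar>f x\<bar>}) =
        emeasure lebesgue (\<Union>n. {x. t + 1 / real (Suc n) < \<bar>f x\<bar>})"
    proof (rule SUP_emeasure_incseq)
      show "range (\<lambda>n. {x. t + 1 / real (Suc n) < \<bar>f x\<bar>}) \<subseteq> sets lebesgue"
        using meas by blast
      show "incseq (\<lambda>n. {x. t + 1 / real (Suc n) < \<bar>f x\<bar>})"
      proof (rule monoI, rule subsetI)
        fix m n :: nat and x
        assume mn: "m \<le> n" and x: "x \<in> {x. t + 1 / real (Suc m) < \<bar>f x\<bar>}"
        have "1 / real (Suc n) \<le> 1 / real (Suc m)" using mn by (simp add: frac_le)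
        then show "x \<in> {x. t + 1 / real (Suc n) < \<bar>f x\<bar>}" using x by auto
      qed
    qed
    also note eq[symmetric]
    finally have "ennreal u < (SUP n. emeasure lebesgue {x. t + 1 / real (Suc n) < \<bar>f x\<bar>})"
      using * by (simp only:)
    then obtain n where n: "ennreal u < emeasure lebesgue {x. t + 1 / real (Suc n) < \<bar>f x\<bar>}"
      unfolding less_SUP_iff by blast
    have "t + 1 / real (Suc n) \<le> Inf S"
    proof (rule cInf_greatest[OF ne])
      fix s assume s: "s \<in> S"
      show "t + 1 / real (Suc n) \<le> s"
      proof (rule ccontr)
        assume "\<not> t + 1 / real (Suc n) \<le> s"
        then have "emeasure lebesgue {x. t + 1 / real (Suc n) < \<bar>f x\<bar>} \<le> emeasure lebesgue {x. s < \<bar>f x\<bar>}"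
          by (intro emeasure_mono meas) auto
        also have "\<dots> \<le> ennreal u" using s unfolding S_def by blast
        finally show False using n by (meson leD)
      qed
    qed
    moreover have "0 < 1 / real (Suc n)" by simp
    ultimately show "t < rearrangement f u" using W by linarith
  qed
qed

lemma rearrangement_nonneg:
  fixes f :: "real ^ 'n \<Rightarrow> real"
  assumes f: "integrable lebesgue f" and u: "0 < u"
  shows "0 \<le> rearrangement f u"
proof (rule ccontr)
  assume neg: "\<not> 0 \<le> rearrangement f u"
  define S where "S = {t. 0 \<le> t \<and> emeasure lebesgue {x. t < \<bar>f x\<bar>} \<le> ennreal u}"
  have W: "rearrangement f u = Inf S"
    by (simp add: rearrangement_def S_def)
  show False
  proof (cases "S = {}")
    case True
    have "ennreal u < emeasure lebesgue {x. t < \<bar>f x\<bar>}" if "0 \<le> t" for t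
    proof (rule ccontr)
      assume "\<not> ?thesis"
      then have "t \<in> S" using that by (simp add: S_def not_less)
      with True show False by simp
    qed
    then have "t < rearrangement f u" if "0 \<le> t" for t
      using rearrangement_gt_iff[OF f u that] that by simp
    from this[of 0] neg show False by simp
  next
    case False
    then have "0 \<le> Inf S" by (intro cInf_greatest) (auto simp: S_def)
    with neg W show False by simp
  qed
qed

lemma rearrangement_antimono:
  fixes f :: "real ^ 'n \<Rightarrow> real"
  assumes f: "integrable lebesgue f" and u: "0 < u" "u \<le> v"
  shows "rearrangement f v \<le> rearrangement f u"
proof (rule ccontr)
  assume "\<not> ?thesis"
  then have "rearrangement f u < rearrangement f v" by simp
  then have "ennreal v < emeasure lebesgue {x. rearrangement f u < \<bar>f x\<bar>}"
    using rearrangement_gt_iff[OF f, of v "rearrangement f u"] rearrangement_nonneg[OF f u(1)] u by auto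
  moreover have "ennreal u \<le> ennreal v" using u by (simp add: ennreal_leI)
  ultimately have "ennreal u < emeasure lebesgue {x. rearrangement f u < \<bar>f x\<bar>}" by simp
  then show False
    using rearrangement_gt_iff[OF f u(1), of "rearrangement f u"] rearrangement_nonneg[OF f u(1)] by auto
qed

lemma rearrangement_measurable:
  fixes f :: "real ^ 'n \<Rightarrow> real"
  assumes f: "integrable lebesgue f"
  shows "(\<lambda>u. if 0 < u then rearrangement f u else 0) \<in> borel_measurable borel"
proof (subst borel_measurable_iff_greater, intro allI)
  fix a :: real
  show "{u \<in> space borel. a < (if 0 < u then rearrangement f u else 0)} \<in> sets borel"
  proof (cases "0 \<le> a")
    case True
    then have "{u \<in> space borel. a < (if 0 < u then rearrangement f u else 0)} =
        {u. 0 < u \<and> ennreal u < emeasure lebesgue {x. a < \<bar>f x\<bar>}}"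
      using rearrangement_gt_iff[OF f] by auto
    then show ?thesis by simp
  next
    case False
    then have "{u \<in> space borel. a < (if 0 < u then rearrangement f u else 0)} = UNIV"
    proof -
      have "a < (if 0 < u then rearrangement f u else 0)" for u
        using rearrangement_nonneg[OF f, of u] False by auto
      then show ?thesis by simp
    qed
    then show ?thesis by simp
  qed
qed

text \<open>
  Equimeasurability. The push-forward of Lebesgue measure on \<open>Q\<close> under \<open>f\<close> and that on \<open>(0, L)\<close>
  under \<open>f\<^sup>*\<close> give the same mass to every half-line \<open>(t, \<infinity>)\<close>, hence they coincide. Positivity of
  \<open>f\<close> on \<open>Q\<close> is what matches the masses for \<open>t < 0\<close> and removes the absolute value.
\<close>

lemma nn_integral_rearrangement:
  fixes f :: "real ^ 'n \<Rightarrow> real" and F :: "real \<Rightarrow> ennreal"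
  assumes f: "integrable lebesgue f" and Q: "Q \<in> sets lebesgue" "emeasure lebesgue Q = ennreal L" "0 < L"
    and pos: "AE x in lebesgue. x \<in> Q \<longrightarrow> 0 < f x" and zero: "\<And>x. x \<notin> Q \<Longrightarrow> f x = 0"
    and F[measurable]: "F \<in> borel_measurable borel"
  shows "(\<integral>\<^sup>+x\<in>Q. F (f x) \<partial>lebesgue) = (\<integral>\<^sup>+u\<in>{0<..<L}. F (rearrangement f u) \<partial>lborel)"
proof -
  note fm[measurable] = borel_measurable_integrable[OF f]
  note [measurable] = Q(1)
  define W where "W = (\<lambda>u. if 0 < u then rearrangement f u else 0)"
  have W[measurable]: "W \<in> borel_measurable borel"
    unfolding W_def by (rule rearrangement_measurable[OF f])
  define M where "M = distr (density lebesgue (indicator Q)) borel f"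
  define N where "N = distr (density lborel (indicator {0<..<L})) borel W"
  have M: "emeasure M A = emeasure lebesgue (Q \<inter> f -` A)" if "A \<in> sets borel" for A
  proof -
    have [measurable]: "f -` A \<in> sets lebesgue"
      using measurable_sets[OF fm that] by simp
    have "emeasure M A = emeasure (density lebesgue (indicator Q)) (f -` A)"
      unfolding M_def using that by (subst emeasure_distr) auto
    also have "\<dots> = emeasure lebesgue (Q \<inter> f -` A)"
      by (subst emeasure_density) (auto simp flip: nn_integral_indicator indicator_inter_arith)
    finally show ?thesis .
  qed
  have N: "emeasure N A = emeasure lborel ({0<..<L} \<inter> W -` A)" if "A \<in> sets borel" for A
  proof -
    have [measurable]: "W -` A \<in> sets borel"
      using measurable_sets[OF W that] by simp
    have "emeasure N A = emeasure (density lborel (indicator {0<..<L})) (W -` A)"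
      unfolding N_def using that by (subst emeasure_distr) auto
    also have "\<dots> = emeasure lborel ({0<..<L} \<inter> W -` A)"
      by (subst emeasure_density) (auto simp flip: nn_integral_indicator indicator_inter_arith)
    finally show ?thesis .
  qed
  have MN: "emeasure M {t<..} = emeasure N {t<..}" for t
  proof (cases "0 \<le> t")
    case True
    define m where "m = emeasure lebesgue {x. t < \<bar>f x\<bar>}"
    have "emeasure M {t<..} = m"
      unfolding m_def
    proof (subst M, simp, rule emeasure_eq_AE)
      show "AE x in lebesgue. (x \<in> Q \<inter> f -` {t<..}) = (x \<in> {x. t < \<bar>f x\<bar>})"
        using pos
      proof eventually_elim
        case (elim x)
        then show ?case using zero[of x] True by (cases "x \<in> Q") auto
      qed
      show "Q \<inter> f -` {t<..} \<in> sets lebesgue"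
        using measurable_sets[OF fm, of "{t<..}"] by auto
      have "{x \<in> space lebesgue. t < \<bar>f x\<bar>} \<in> sets lebesgue" by measurable
      then show "{x. t < \<bar>f x\<bar>} \<in> sets lebesgue" by simp
    qed
    have "m \<le> emeasure lebesgue Q"
      unfolding m_def
    proof (rule emeasure_mono)
      show "{x. t < \<bar>f x\<bar>} \<subseteq> Q"
      proof
        fix x assume "x \<in> {x. t < \<bar>f x\<bar>}"
        then show "x \<in> Q" using zero[of x] True by (cases "x \<in> Q") auto
      qed
    qed (rule Q(1))
    then have mL: "m \<le> ennreal L" using Q by simp
    then obtain m' where m': "m = ennreal m'" "0 \<le> m'" "m' \<le> L"
      using Q(3) by (cases m) (auto simp: ennreal_le_iff top_unique)
    have "u \<in> {0<..<L} \<inter> W -` {t<..} \<longleftrightarrow> u \<in> {0<..<m'}" for u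
    proof (cases "0 < u")
      case True
      then have "t < W u \<longleftrightarrow> ennreal u < ennreal m'"
        using rearrangement_gt_iff[OF f True \<open>0 \<le> t\<close>] m'(1) by (simp add: W_def m_def)
      also have "\<dots> \<longleftrightarrow> u < m'" using True by (simp add: ennreal_less_iff)
      finally show ?thesis using True m'(3) by auto
    qed simp
    then have "{0<..<L} \<inter> W -` {t<..} = {0<..<m'}" by blast
    then have "emeasure N {t<..} = m" using m' by (subst N) auto
    with \<open>emeasure M {t<..} = m\<close> show ?thesis by simp
  next
    case False
    have "emeasure M {t<..} = emeasure lebesgue Q"
    proof (subst M, simp, rule emeasure_eq_AE)
      show "AE x in lebesgue. (x \<in> Q \<inter> f -` {t<..}) = (x \<in> Q)"
        using pos by eventually_elim (use False in auto)
      show "Q \<inter> f -` {t<..} \<in> sets lebesgue"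
        using measurable_sets[OF fm, of "{t<..}"] by auto
    qed simp
    moreover have "{0<..<L} \<inter> W -` {t<..} = {0<..<L}"
    proof -
      have "t < W u" if "0 < u" for u
        using rearrangement_nonneg[OF f that] False that by (simp add: W_def)
      then show ?thesis by auto
    qed
    ultimately show ?thesis using Q by (subst N) auto
  qed
  have "M = N"
  proof (rule measure_eqI_lessThan)
    show "sets M = sets borel" "sets N = sets borel" by (auto simp: M_def N_def)
    fix x
    have "emeasure M {x<..} \<le> emeasure lebesgue Q"
      by (subst M) (simp, intro emeasure_mono Int_lower1 Q(1))
    then show "emeasure M {x<..} < \<infinity>" using Q by (simp add: order_le_less_trans)
    show "emeasure M {x<..} = emeasure N {x<..}" by (rule MN)
  qed
  have "(\<integral>\<^sup>+x\<in>Q. F (f x) \<partial>lebesgue) = (\<integral>\<^sup>+x. F x \<partial>M)"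
    unfolding M_def by (simp add: nn_integral_distr nn_integral_density mult.commute)
  also have "\<dots> = (\<integral>\<^sup>+u\<in>{0<..<L}. F (W u) \<partial>lborel)"
    unfolding \<open>M = N\<close> unfolding N_def by (simp add: nn_integral_distr nn_integral_density mult.commute)
  also have "\<dots> = (\<integral>\<^sup>+u\<in>{0<..<L}. F (rearrangement f u) \<partial>lborel)"
    by (intro nn_integral_cong) (auto simp: W_def indicator_def)
  finally show ?thesis .
qed

section \<open>Dyadic cells of a cube\<close>

text \<open>
  The cells of generation \<open>k\<close> in the grid with origin \<open>a\<close> and unit \<open>l\<close> are the classes of points
  with the same index. Half-open cells partition the space exactly, so that the selection arguments
  below are free of overlaps on faces; the closed cubes of the theorem are recovered up to null sets.
\<close>

definition dyadic_index :: "real ^ 'n \<Rightarrow> real \<Rightarrow> nat \<Rightarrow> real ^ 'n \<Rightarrow> int ^ 'n" where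
  "dyadic_index a l k x = (\<chi> i. \<lfloor>2 ^ k * (x $ i - a $ i) / l\<rfloor>)"

definition cell :: "real ^ 'n \<Rightarrow> real \<Rightarrow> nat \<Rightarrow> real ^ 'n \<Rightarrow> (real ^ 'n) set" where
  "cell a l k x = {y. dyadic_index a l k y = dyadic_index a l k x}"

lemma cell_self: "x \<in> cell a l k x"
  by (simp add: cell_def)

lemma cell_eq: "y \<in> cell a l k x \<Longrightarrow> cell a l k y = cell a l k x"
  by (simp add: cell_def)

lemma cell_Suc_subset: "cell a l (Suc k) x \<subseteq> cell a l k x"
proof -
  have "\<lfloor>2 ^ k * (y $ i - a $ i) / l\<rfloor> = \<lfloor>2 ^ Suc k * (y $ i - a $ i) / l\<rfloor> div 2" for y i
  proof -
    have "2 ^ k * (y $ i - a $ i) / l = (2 ^ Suc k * (y $ i - a $ i) / l) / real_of_int 2"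
      by simp
    then show ?thesis by (metis floor_divide_real_eq_div zero_le_numeral)
  qed
  then show ?thesis
    by (auto simp: cell_def dyadic_index_def vec_eq_iff)
qed

lemma cell_antimono: "k \<le> j \<Longrightarrow> cell a l j x \<subseteq> cell a l k x"
  by (induction j rule: dec_induct) (use cell_Suc_subset in blast)+

definition corner :: "real ^ 'n \<Rightarrow> real \<Rightarrow> nat \<Rightarrow> real ^ 'n \<Rightarrow> real ^ 'n" where
  "corner a l k x = (\<chi> i. a $ i + l / 2 ^ k * of_int (dyadic_index a l k x $ i))"

lemma cell_eq_corner:
  assumes "0 < l"
  shows "cell a l k x = {y. \<forall>i. corner a l k x $ i \<le> y $ i \<and> y $ i < corner a l k x $ i + l / 2 ^ k}"
proof -
  have "\<lfloor>2 ^ k * (y $ i - a $ i) / l\<rfloor> = m \<longleftrightarrow>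
      a $ i + l / 2 ^ k * of_int m \<le> y $ i \<and> y $ i < a $ i + l / 2 ^ k * of_int m + l / 2 ^ k" for y i m
    unfolding floor_eq_iff using assms by (auto simp: field_simps)
  then show ?thesis
    by (simp add: cell_def corner_def vec_eq_iff dyadic_index_def)
qed

definition closed_cell :: "real ^ 'n \<Rightarrow> real \<Rightarrow> nat \<Rightarrow> real ^ 'n \<Rightarrow> (real ^ 'n) set" where
  "closed_cell a l k x = cbox (corner a l k x) (corner a l k x + (\<chi> i. l / 2 ^ k))"

lemma closed_cell_cubes: "0 < l \<Longrightarrow> closed_cell a l k x \<in> cubes"
  unfolding closed_cell_def cubes_def
  by (rule CollectI, rule exI[of _ "corner a l k x"], rule exI[of _ "corner a l k x + (\<chi> i. l / 2 ^ k)"])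
    (auto intro!: exI[of _ "l / 2 ^ k"])

lemma cell_subset_closed_cell: "0 < l \<Longrightarrow> cell a l k x \<subseteq> closed_cell a l k x"
  by (auto simp: cell_eq_corner closed_cell_def mem_box_cart less_imp_le)

lemma negligible_closed_cell_diff: 
  assumes "0 < l"
  shows "negligible (closed_cell a l k x - cell a l k x)"
proof (rule negligible_subset)
  show "negligible (closed_cell a l k x - box (corner a l k x) (corner a l k x + (\<chi> i. l / 2 ^ k)))"
    unfolding closed_cell_def by (rule negligible_frontier_interval)
  show "closed_cell a l k x - cell a l k x
      \<subseteq> closed_cell a l k x - box (corner a l k x) (corner a l k x + (\<chi> i. l / 2 ^ k))"
    using assms by (auto simp: cell_eq_corner mem_box_cart less_imp_le)
qed

lemma measure_cube:
  fixes a :: "real ^ 'n"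
  assumes "0 < l" and "\<And>i. b $ i = a $ i + l"
  shows "emeasure lebesgue (cbox a b) = ennreal (l ^ CARD('n))"
    "measure lebesgue (cbox a b) = l ^ CARD('n)"
proof -
  have "a \<in> cbox a b" using assms by (auto simp: mem_box_cart)
  then have "measure lborel (cbox a b) = l ^ CARD('n)"
    using assms by (subst content_cbox_cart) auto
  then show *: "measure lebesgue (cbox a b) = l ^ CARD('n)" by simp
  show "emeasure lebesgue (cbox a b) = ennreal (l ^ CARD('n))"
    by (subst emeasure_eq_measure2) (auto simp: *)
qed

lemma closed_cell_sets [measurable]: "closed_cell a l k x \<in> sets lebesgue"
  by (simp add: closed_cell_def)

lemma cell_sets [measurable]:
  assumes "0 < l"
  shows "cell a l k x \<in> sets lebesgue"
proof -
  have "closed_cell a l k x - (closed_cell a l k x - cell a l k x) \<in> sets lebesgue"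
    by (intro sets.Diff closed_cell_sets negligible_imp_sets negligible_closed_cell_diff assms)
  moreover have "closed_cell a l k x - (closed_cell a l k x - cell a l k x) = cell a l k x"
    using cell_subset_closed_cell[OF assms, of a k x] by blast
  ultimately show ?thesis by simp
qed

lemma emeasure_closed_cell_eq:
  assumes "0 < l" and [measurable]: "F \<in> borel_measurable lebesgue"
  shows "emeasure (density lebesgue F) (closed_cell a l k x) = emeasure (density lebesgue F) (cell a l k x)"
proof -
  have AE: "AE y in lebesgue. (y \<in> closed_cell a l k x) = (y \<in> cell a l k x)"
    using negligible_closed_cell_diff[OF assms(1), of a k x] cell_subset_closed_cell[OF assms(1), of a k x]
    by (auto simp: negligible_iff_null_sets elim!: AE_not_in[THEN eventually_mono])
  have [measurable]: "cell a l k x \<in> sets lebesgue" by (rule cell_sets[OF assms(1)])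
  have "AE y in density lebesgue F. (y \<in> closed_cell a l k x) = (y \<in> cell a l k x)"
    using AE by (auto simp: AE_density elim!: eventually_mono)
  then show ?thesis
    by (rule emeasure_eq_AE) auto
qed

lemma emeasure_cell:
  fixes a :: "real ^ 'n"
  assumes "0 < l"
  shows "emeasure lebesgue (cell a l k x) = ennreal ((l / 2 ^ k) ^ CARD('n))"
proof -
  have "emeasure lebesgue (cell a l k x) = emeasure lebesgue (closed_cell a l k x)"
    using emeasure_closed_cell_eq[OF assms, of "\<lambda>_. 1" a k x] cell_sets[OF assms, of a k x]
    by (simp add: density_1)
  also have "\<dots> = ennreal ((l / 2 ^ k) ^ CARD('n))"
    unfolding closed_cell_def using assms by (intro measure_cube) auto
  finally show ?thesis .
qed

lemma corner_0: "corner a l 0 a = a"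
  by (simp add: corner_def dyadic_index_def vec_eq_iff)

lemma closed_cell_0: "closed_cell a l 0 a = cbox a (a + (\<chi> i. l))"
  by (simp add: closed_cell_def corner_0)

lemma closed_cell_subset:
  assumes "0 < l" "x \<in> cell a l 0 a"
  shows "closed_cell a l k x \<subseteq> closed_cell a l 0 a"
proof -
  note c0 = corner_0[of a l]
  have x: "a $ i \<le> x $ i \<and> x $ i < a $ i + l" for i
    using assms by (simp add: cell_eq_corner c0)
  have b: "a $ i \<le> corner a l k x $ i \<and> corner a l k x $ i + l / 2 ^ k \<le> a $ i + l" for i
  proof -
    define m where "m = \<lfloor>2 ^ k * (x $ i - a $ i) / l\<rfloor>"
    have "0 \<le> m" using x[of i] assms by (auto simp: m_def)
    have "2 ^ k * (x $ i - a $ i) / l < 2 ^ k"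
    proof -
      have "x $ i - a $ i < l" using x[of i] by simp
      then have "2 ^ k * (x $ i - a $ i) < 2 ^ k * l" by simp
      then show ?thesis using assms by (simp add: pos_divide_less_eq)
    qed
    then have "m < 2 ^ k" by (simp add: m_def floor_less_iff)
    then have "real_of_int m + 1 \<le> 2 ^ k"
    proof -
      have "m + 1 \<le> 2 ^ k" using \<open>m < 2 ^ k\<close> by simp
      then have "real_of_int (m + 1) \<le> real_of_int (2 ^ k)" by (simp only: of_int_le_iff)
      then show ?thesis by simp
    qed
    then have "l / 2 ^ k * (real_of_int m + 1) \<le> l / 2 ^ k * 2 ^ k"
      using assms by (intro mult_left_mono) auto
    then have "l / 2 ^ k * real_of_int m + l / 2 ^ k \<le> l"
      by (simp add: algebra_simps add_divide_distrib)
    with \<open>0 \<le> m\<close> assms show ?thesis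
      by (simp add: corner_def dyadic_index_def m_def[symmetric])
  qed
  show ?thesis
  proof
    fix y assume y: "y \<in> closed_cell a l k x"
    have "a $ i \<le> y $ i \<and> y $ i \<le> a $ i + l" for i
    proof -
      have "corner a l k x $ i \<le> y $ i \<and> y $ i \<le> corner a l k x $ i + l / 2 ^ k"
        using y by (simp add: closed_cell_def mem_box_cart)
      with b[of i] show ?thesis by linarith
    qed
    then show "y \<in> closed_cell a l 0 a"
      by (simp add: closed_cell_0 mem_box_cart)
  qed
qed

lemma cell_shrinks:
  fixes a :: "real ^ 'n"
  assumes "0 < l" "open U" "x \<in> U"
  shows "\<exists>k. cell a l k x \<subseteq> U"
proof -
  obtain e where e: "e > 0" "ball x e \<subseteq> U" using assms open_contains_ball by blast
  obtain k where k: "(1 / 2) ^ k < e / (real CARD('n) * l)"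
    using real_arch_pow_inv[of "e / (real CARD('n) * l)" "1/2"] e assms by auto
  have "cell a l k x \<subseteq> ball x e"
  proof
    fix y assume y: "y \<in> cell a l k x"
    have "\<bar>(x - y) $ i\<bar> \<le> l / 2 ^ k" for i
    proof -
      have "corner a l k x $ i \<le> y $ i \<and> y $ i < corner a l k x $ i + l / 2 ^ k"
        using y by (simp add: cell_eq_corner[OF assms(1)])
      moreover have "corner a l k x $ i \<le> x $ i \<and> x $ i < corner a l k x $ i + l / 2 ^ k"
        using cell_self[of x a l k] unfolding cell_eq_corner[OF assms(1)] by blast
      ultimately show ?thesis by (simp add: abs_le_iff)
    qed
    then have "norm (x - y) \<le> (\<Sum>i\<in>(UNIV::'n set). l / 2 ^ k)"
      by (intro order_trans[OF norm_le_l1_cart] sum_mono)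
    also have "\<dots> = real CARD('n) * l * (1 / 2) ^ k" by (simp add: power_one_over)
    also have "\<dots> < e" using k assms by (simp add: field_simps)
    finally show "y \<in> ball x e" by (simp add: dist_norm)
  qed
  with e show ?thesis by blast
qed

text \<open>
  Around each point take the largest cell that satisfies \<open>Pr\<close>. Two such cells that meet are nested,
  and then equal by maximality. Countability comes from the countable set of indices.
\<close>

lemma dyadic_selection:
  fixes a :: "real ^ 'n" and Pr :: "(real ^ 'n) set \<Rightarrow> bool"
  obtains \<F> where "countable \<F>" "disjoint \<F>"
    "{x \<in> S. \<exists>k. Pr (cell a l k x)} \<subseteq> \<Union>\<F>"
    "\<And>P. P \<in> \<F> \<Longrightarrow> \<exists>k x. x \<in> S \<and> P = cell a l k x \<and> Pr P \<and> (\<forall>j<k. \<not> Pr (cell a l j x))"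
proof -
  define k where "k x = (LEAST k. Pr (cell a l k x))" for x
  define A where "A = {x \<in> S. \<exists>k. Pr (cell a l k x)}"
  define \<F> where "\<F> = (\<lambda>x. cell a l (k x) x) ` A"
  have least: "Pr (cell a l (k x) x)" "\<And>j. j < k x \<Longrightarrow> \<not> Pr (cell a l j x)" if "x \<in> A" for x
    using that unfolding A_def k_def by (auto intro: LeastI dest: not_less_Least)
  have eq: "cell a l (k x) x = cell a l (k y) y"
    if xy: "x \<in> A" "y \<in> A" "k x \<le> k y" and z: "z \<in> cell a l (k x) x" "z \<in> cell a l (k y) y" for x y z
  proof -
    have "cell a l (k x) x = cell a l (k x) z" using z cell_eq by blast
    moreover have "cell a l (k x) y = cell a l (k x) z"
      using z cell_antimono[OF xy(3), of a l y] cell_eq by blast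
    ultimately have *: "cell a l (k x) x = cell a l (k x) y" by simp
    with least(1)[OF xy(1)] least(2)[OF xy(2)] have "\<not> k x < k y" by auto
    with xy(3) * show ?thesis by simp
  qed
  show thesis
  proof
    have "\<F> \<subseteq> (\<lambda>(k, m). {y. dyadic_index a l k y = m}) ` UNIV"
      by (auto simp: \<F>_def cell_def)
    then show "countable \<F>" by (rule countable_subset) simp
    show "disjoint \<F>"
    proof (rule disjointI)
      fix P R assume "P \<in> \<F>" "R \<in> \<F>" "P \<noteq> R"
      then obtain x y where "x \<in> A" "y \<in> A" "P = cell a l (k x) x" "R = cell a l (k y) y"
        by (auto simp: \<F>_def)
      with \<open>P \<noteq> R\<close> show "P \<inter> R = {}"
        using eq[of x y] eq[of y x] nle_le[of "k x" "k y"] by blast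
    qed
    show "{x \<in> S. \<exists>k. Pr (cell a l k x)} \<subseteq> \<Union>\<F>"
      unfolding \<F>_def A_def[symmetric] using cell_self by blast
    show "\<exists>k x. x \<in> S \<and> P = cell a l k x \<and> Pr P \<and> (\<forall>j<k. \<not> Pr (cell a l j x))" if "P \<in> \<F>" for P
    proof -
      from that obtain x where "x \<in> A" "P = cell a l (k x) x" by (auto simp: \<F>_def)
      moreover from this have "x \<in> S" by (simp add: A_def)
      ultimately show ?thesis using least[of x] by blast
    qed
  qed
qed

lemma emeasure_Union_le:
  assumes "countable \<F>" "disjoint \<F>" "\<And>P. P \<in> \<F> \<Longrightarrow> P \<in> sets M" "sets N = sets M"
    and le: "\<And>P. P \<in> \<F> \<Longrightarrow> emeasure N P \<le> c * emeasure M P"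
  shows "emeasure N (\<Union>\<F>) \<le> c * emeasure M (\<Union>\<F>)"
proof -
  have dj: "disjoint_family_on (\<lambda>P. P) \<F>"
    using assms(2) by (auto simp: disjoint_family_on_def disjoint_def)
  have "emeasure N (\<Union>\<F>) = (\<integral>\<^sup>+P. emeasure N P \<partial>count_space \<F>)"
    using emeasure_UN_countable[of \<F> "\<lambda>P. P" N] assms dj by simp
  also have "\<dots> \<le> (\<integral>\<^sup>+P. c * emeasure M P \<partial>count_space \<F>)"
    using le by (intro nn_integral_mono) auto
  also have "\<dots> = c * (\<integral>\<^sup>+P. emeasure M P \<partial>count_space \<F>)"
    by (rule nn_integral_cmult) simp
  also have "(\<integral>\<^sup>+P. emeasure M P \<partial>count_space \<F>) = emeasure M (\<Union>\<F>)"
    using emeasure_UN_countable[of \<F> "\<lambda>P. P" M] assms dj by simp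
  finally show ?thesis .
qed

section \<open>Calderon-Zygmund decomposition\<close>

text \<open>
  Lebesgue's differentiation theorem in the form needed, without a maximal function. If \<open>f > \<mu> > lam\<close>
  on a set \<open>B\<close> of positive measure, enclose \<open>B\<close> in an open set \<open>U\<close> of nearly the same measure and
  cover \<open>B\<close> by disjoint cells that lie in \<open>U\<close> and meet \<open>B\<close>. Their averages are at most \<open>lam\<close>, so
  \<open>\<mu> |B| \<le> lam |U|\<close>, which is a contradiction when \<open>U\<close> is close to \<open>B\<close>.
\<close>

lemma AE_le_off_heavy_cells:
  fixes a :: "real ^ 'n" and f :: "real ^ 'n \<Rightarrow> real"
  assumes l: "0 < l" and lam: "0 \<le> lam" and f[measurable]: "f \<in> borel_measurable lebesgue"
    and A: "A \<in> sets lebesgue" "A \<subseteq> cell a l 0 a"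
    and light: "\<And>x k. x \<in> A \<Longrightarrow>
      emeasure (density lebesgue (\<lambda>x. ennreal (f x))) (cell a l k x) \<le> ennreal lam * emeasure lebesgue (cell a l k x)"
  shows "AE x in lebesgue. x \<in> A \<longrightarrow> f x \<le> lam"
proof -
  let ?\<nu> = "density lebesgue (\<lambda>x. ennreal (f x))"
  have null: "emeasure lebesgue {x \<in> A. mu < f x} = 0" if mu: "lam < mu" for mu
  proof (rule ccontr)
    define B where "B = {x \<in> A. mu < f x}"
    have B[measurable]: "B \<in> sets lebesgue"
    proof -
      have "A \<inter> {x \<in> space lebesgue. mu < f x} \<in> sets lebesgue"
        by (intro sets.Int A) measurable
      also have "A \<inter> {x \<in> space lebesgue. mu < f x} = B" by (auto simp: B_def)
      finally show ?thesis .
    qed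
    have "emeasure lebesgue B \<le> emeasure lebesgue (cell a l 0 a)"
      using A l by (intro emeasure_mono cell_sets) (auto simp: B_def)
    also have "\<dots> < \<infinity>" unfolding emeasure_cell[OF l] by simp
    finally obtain \<beta> where \<beta>: "emeasure lebesgue B = ennreal \<beta>" "0 \<le> \<beta>"
      by (cases "emeasure lebesgue B") auto
    assume "emeasure lebesgue {x \<in> A. mu < f x} \<noteq> 0"
    then have "0 < \<beta>" using \<beta> unfolding B_def[symmetric] by (cases "\<beta> = 0") auto
    \<comment> \<open>any excess e with lam * e < (mu - lam) * beta will do; lam may be 0\<close>
    define e where "e = (mu - lam) * \<beta> / (lam + 1)"
    have "0 < e" using mu \<open>0 < \<beta>\<close> lam by (simp add: e_def)
    obtain U where U: "open U" "B \<subseteq> U" "U - B \<in> lmeasurable" "emeasure lebesgue (U - B) < ennreal e"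
      using sets_lebesgue_outer_open[OF B \<open>0 < e\<close>] by blast
    have [measurable]: "U \<in> sets lebesgue" using U(1) by simp
    have "emeasure lebesgue U = emeasure lebesgue B + emeasure lebesgue (U - B)"
    proof -
      have "emeasure lebesgue B + emeasure lebesgue (U - B) = emeasure lebesgue (B \<union> (U - B))"
        using U(3) by (intro plus_emeasure) (auto simp: fmeasurable_def)
      also have "B \<union> (U - B) = U" using U(2) by blast
      finally show ?thesis by simp
    qed
    also have "\<dots> \<le> ennreal \<beta> + ennreal e"
      using U(4) \<beta> by (intro add_mono) auto
    finally have mU: "emeasure lebesgue U \<le> ennreal (\<beta> + e)"
      using \<beta> \<open>0 < e\<close> by (simp add: ennreal_plus)
    define Pr where "Pr C \<longleftrightarrow> C \<subseteq> U \<and> C \<inter> B \<noteq> {}" for C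
    obtain \<F> where \<F>: "countable \<F>" "disjoint \<F>" "{x \<in> B. \<exists>k. Pr (cell a l k x)} \<subseteq> \<Union>\<F>"
      "\<And>P. P \<in> \<F> \<Longrightarrow> \<exists>k x. x \<in> B \<and> P = cell a l k x \<and> Pr P \<and> (\<forall>j<k. \<not> Pr (cell a l j x))"
      using dyadic_selection[of B Pr a l] by blast
    have "B \<subseteq> \<Union>\<F>"
    proof
      fix x assume x: "x \<in> B"
      then obtain k where "cell a l k x \<subseteq> U" using cell_shrinks[OF l U(1), of x] U(2) by blast
      then show "x \<in> \<Union>\<F>" using x \<F>(3) cell_self[of x a l k] unfolding Pr_def by blast
    qed
    have sets: "P \<in> sets lebesgue" if "P \<in> \<F>" for P
      using \<F>(4)[OF that] cell_sets[OF l] by blast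
    have [measurable]: "\<Union>\<F> \<in> sets lebesgue" using \<F>(1) sets by blast
    have "ennreal (mu * \<beta>) = (\<integral>\<^sup>+x. ennreal mu * indicator B x \<partial>lebesgue)"
      using \<beta> lam mu by (subst nn_integral_cmult_indicator) (auto simp: ennreal_mult)
    also have "\<dots> \<le> (\<integral>\<^sup>+x. ennreal (f x) * indicator B x \<partial>lebesgue)"
      by (intro nn_integral_mono) (auto simp: indicator_def B_def intro!: ennreal_leI)
    also have "\<dots> = emeasure ?\<nu> B"
      by (subst emeasure_density) auto
    also have "\<dots> \<le> emeasure ?\<nu> (\<Union>\<F>)"
      using \<open>B \<subseteq> \<Union>\<F>\<close> by (intro emeasure_mono) auto
    also have "\<dots> \<le> ennreal lam * emeasure lebesgue (\<Union>\<F>)"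
    proof (rule emeasure_Union_le[OF \<F>(1,2) sets])
      fix P assume "P \<in> \<F>"
      then obtain k x where "x \<in> B" "P = cell a l k x" using \<F>(4) by blast
      then show "emeasure ?\<nu> P \<le> ennreal lam * emeasure lebesgue P"
        using light[of x k] by (simp add: B_def)
    qed auto
    also have "\<dots> \<le> ennreal lam * emeasure lebesgue U"
    proof (intro mult_left_mono emeasure_mono)
      show "\<Union>\<F> \<subseteq> U" using \<F>(4) unfolding Pr_def by blast
    qed auto
    also have "\<dots> \<le> ennreal lam * ennreal (\<beta> + e)"
      by (intro mult_left_mono mU) auto
    finally have "ennreal (mu * \<beta>) \<le> ennreal (lam * (\<beta> + e))"
      using lam \<beta> \<open>0 < e\<close> by (simp add: ennreal_mult)
    then have "mu * \<beta> \<le> lam * (\<beta> + e)"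
      using lam \<beta> \<open>0 < e\<close> by (simp add: ennreal_le_iff)
    moreover have "lam * e < (mu - lam) * \<beta>"
    proof -
      have "(lam + 1) * e = (mu - lam) * \<beta>" using lam by (simp add: e_def)
      then show ?thesis using \<open>0 < e\<close> by (simp add: algebra_simps)
    qed
    ultimately show False by (simp add: algebra_simps)
  qed
  have "AE x in lebesgue. \<forall>n. x \<in> A \<longrightarrow> f x \<le> lam + 1 / real (Suc n)"
  proof (subst AE_all_countable, intro allI)
    fix n
    have "{x \<in> A. lam + 1 / real (Suc n) < f x} \<in> sets lebesgue"
    proof -
      have "A \<inter> {x \<in> space lebesgue. lam + 1 / real (Suc n) < f x} \<in> sets lebesgue"
        by (intro sets.Int A) measurable
      also have "A \<inter> {x \<in> space lebesgue. lam + 1 / real (Suc n) < f x} = {x \<in> A. lam + 1 / real (Suc n) < f x}"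
        by auto
      finally show ?thesis .
    qed
    then have "{x \<in> A. lam + 1 / real (Suc n) < f x} \<in> null_sets lebesgue"
      using null[of "lam + 1 / real (Suc n)"] by (simp add: null_sets_def)
    then show "AE x in lebesgue. x \<in> A \<longrightarrow> f x \<le> lam + 1 / real (Suc n)"
      by (rule AE_I') auto
  qed
  then show ?thesis
  proof eventually_elim
    case (elim x)
    show ?case
    proof
      assume "x \<in> A"
      show "f x \<le> lam"
      proof (rule field_le_epsilon)
        fix e :: real assume "0 < e"
        then obtain n where "inverse (real (Suc n)) < e" by (metis reals_Archimedean)
        moreover have "f x \<le> lam + 1 / real (Suc n)" using elim \<open>x \<in> A\<close> by blast
        ultimately show "f x \<le> lam + e" by (simp only: inverse_eq_divide)
      qed
    qed
  qed
qed

text \<open>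
  The maximal cells with average above \<open>lam\<close>. The parent of such a cell has average at most \<open>lam\<close> and
  is \<open>2\<^sup>n\<close> times as large, which bounds the average from above; the parent exists because the root cell
  does not qualify. As the hypotheses on weights concern closed cubes, each cell comes with its
  closure \<open>P'\<close>.
\<close>

lemma calderon_zygmund:
  fixes a :: "real ^ 'n" and f :: "real ^ 'n \<Rightarrow> real"
  defines "\<nu> \<equiv> density lebesgue (\<lambda>x. ennreal (f x))"
  assumes l: "0 < l" and lam: "0 \<le> lam" and f[measurable]: "f \<in> borel_measurable lebesgue"
    and Q: "Q = cbox a (a + (\<chi> i. l))"
    and avg: "emeasure \<nu> Q \<le> ennreal lam * emeasure lebesgue Q"
  obtains \<F> where "countable \<F>" "disjoint \<F>" "\<And>P. P \<in> \<F> \<Longrightarrow> P \<in> sets lebesgue" "\<Union>\<F> \<subseteq> Q"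
    "\<And>P. P \<in> \<F> \<Longrightarrow> ennreal lam * emeasure lebesgue P \<le> emeasure \<nu> P"
    "\<And>P. P \<in> \<F> \<Longrightarrow> \<exists>P'\<in>cubes. P \<subseteq> P' \<and> P' \<subseteq> Q \<and> negligible (P' - P) \<and>
        emeasure \<nu> P' \<le> ennreal (2 ^ CARD('n) * lam) * emeasure lebesgue P'"
    "AE x in lebesgue. x \<in> Q - \<Union>\<F> \<longrightarrow> f x \<le> lam"
proof -
  have fm: "(\<lambda>x. ennreal (f x)) \<in> borel_measurable lebesgue" by measurable
  have Qc: "Q = closed_cell a l 0 a" by (simp add: Q closed_cell_0)
  define Q0 where "Q0 = cell a l 0 a"
  define Pr where "Pr P \<longleftrightarrow> ennreal lam * emeasure lebesgue P < emeasure \<nu> P" for P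
  have closed: "emeasure \<nu> (closed_cell a l k x) = emeasure \<nu> (cell a l k x)"
    "emeasure lebesgue (closed_cell a l k x) = emeasure lebesgue (cell a l k x)" for k x
  proof -
    show "emeasure \<nu> (closed_cell a l k x) = emeasure \<nu> (cell a l k x)"
      unfolding \<nu>_def by (rule emeasure_closed_cell_eq[OF l fm])
    show "emeasure lebesgue (closed_cell a l k x) = emeasure lebesgue (cell a l k x)"
      using emeasure_closed_cell_eq[OF l, of "\<lambda>_. 1" a k x] unfolding density_1 by simp
  qed
  obtain \<F> where \<F>: "countable \<F>" "disjoint \<F>" "{x \<in> Q0. \<exists>k. Pr (cell a l k x)} \<subseteq> \<Union>\<F>"
    "\<And>P. P \<in> \<F> \<Longrightarrow> \<exists>k x. x \<in> Q0 \<and> P = cell a l k x \<and> Pr P \<and> (\<forall>j<k. \<not> Pr (cell a l j x))"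
    using dyadic_selection[of Q0 Pr a l] by blast
  show thesis
  proof (rule that[OF \<F>(1,2)])
    show sets: "P \<in> sets lebesgue" if "P \<in> \<F>" for P
      using \<F>(4)[OF that] cell_sets[OF l] by blast
    show sub: "\<Union>\<F> \<subseteq> Q"
    proof
      fix y assume "y \<in> \<Union>\<F>"
      then obtain k x where "x \<in> Q0" "y \<in> cell a l k x" using \<F>(4) by blast
      then show "y \<in> Q"
        using closed_cell_subset[OF l, of x a k] cell_subset_closed_cell[OF l, of a k x]
        unfolding Q0_def Qc by blast
    qed
    show "ennreal lam * emeasure lebesgue P \<le> emeasure \<nu> P" if "P \<in> \<F>" for P
      using \<F>(4)[OF that] unfolding Pr_def by (auto intro: less_imp_le)
    show "\<exists>P'\<in>cubes. P \<subseteq> P' \<and> P' \<subseteq> Q \<and> negligible (P' - P) \<and>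
        emeasure \<nu> P' \<le> ennreal (2 ^ CARD('n) * lam) * emeasure lebesgue P'" if P: "P \<in> \<F>" for P
    proof -
      obtain k x where kx: "x \<in> Q0" "P = cell a l k x" "Pr P" "\<And>j. j < k \<Longrightarrow> \<not> Pr (cell a l j x)"
        using \<F>(4)[OF P] by blast
      have "k \<noteq> 0"
      proof
        assume "k = 0"
        then have "P = Q0" using kx(1,2) cell_eq[of x a l 0 a] by (simp add: Q0_def)
        moreover have "\<not> Pr Q0"
          using avg unfolding Pr_def Q0_def Qc closed by (simp only: not_less)
        ultimately show False using kx(3) by simp
      qed
      then obtain j where j: "k = Suc j" by (cases k) auto
      have "emeasure \<nu> P \<le> emeasure \<nu> (cell a l j x)"
        using cell_Suc_subset[of a l j x] cell_sets[OF l, of a j x] unfolding kx(2) j \<nu>_def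
        by (intro emeasure_mono) auto
      also have "\<dots> \<le> ennreal lam * emeasure lebesgue (cell a l j x)"
        using kx(4)[of j] unfolding Pr_def j by (simp only: not_less lessI simp_thms)
      also have "\<dots> = ennreal lam * ennreal ((l / 2 ^ j) ^ CARD('n))"
        unfolding emeasure_cell[OF l] ..
      also have "\<dots> = ennreal (2 ^ CARD('n) * lam) * ennreal ((l / 2 ^ k) ^ CARD('n))"
        using lam l unfolding j by (simp add: power_divide field_simps flip: ennreal_mult)
      also have "\<dots> = ennreal (2 ^ CARD('n) * lam) * emeasure lebesgue P"
        unfolding emeasure_cell[OF l] kx(2) ..
      finally have "emeasure \<nu> P \<le> ennreal (2 ^ CARD('n) * lam) * emeasure lebesgue P" .
      then have "emeasure \<nu> (closed_cell a l k x)
          \<le> ennreal (2 ^ CARD('n) * lam) * emeasure lebesgue (closed_cell a l k x)"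
        unfolding kx(2) closed .
      moreover have "closed_cell a l k x \<subseteq> Q"
        using kx(1) closed_cell_subset[OF l, of x a k] unfolding Qc Q0_def by simp
      ultimately show ?thesis
        unfolding kx(2)
        by (intro bexI[OF _ closed_cell_cubes[OF l, of a k x]] conjI
            cell_subset_closed_cell[OF l] negligible_closed_cell_diff[OF l])
    qed
    have U: "\<Union>\<F> \<in> sets lebesgue" using \<F>(1) sets by blast
    have 1: "AE x in lebesgue. x \<in> Q0 - \<Union>\<F> \<longrightarrow> f x \<le> lam"
    proof (rule AE_le_off_heavy_cells[OF l lam f])
      show "Q0 - \<Union>\<F> \<in> sets lebesgue" using U cell_sets[OF l] unfolding Q0_def by blast
      fix x k assume "x \<in> Q0 - \<Union>\<F>"
      then have "\<not> Pr (cell a l k x)" using \<F>(3) by blast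
      then show "emeasure (density lebesgue (\<lambda>x. ennreal (f x))) (cell a l k x)
          \<le> ennreal lam * emeasure lebesgue (cell a l k x)"
        unfolding Pr_def \<nu>_def by (simp only: not_less)
    qed (auto simp: Q0_def)
    have 2: "AE x in lebesgue. x \<notin> Q - Q0"
      using negligible_closed_cell_diff[OF l, of a 0 a] unfolding Qc Q0_def
      by (intro AE_not_in) (simp add: negligible_iff_null_sets)
    show "AE x in lebesgue. x \<in> Q - \<Union>\<F> \<longrightarrow> f x \<le> lam"
      using 1 2 by eventually_elim blast
  qed
qed

section \<open>A weight on a fixed cube\<close>

text \<open>
  Throughout, \<open>W\<close> is the rearrangement of \<open>wQ = w \<chi>\<^sub>Q\<close> and lives on \<open>(0, L)\<close>. Cutting \<open>w\<close> off at
  \<open>Q\<close> makes it globally measurable and integrable, and agrees with \<open>w\<close> on every subcube of \<open>Q\<close>.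
\<close>

locale weight_on_cube =
  fixes w :: "real ^ 'n \<Rightarrow> real" and Q :: "(real ^ 'n) set"
  assumes w: "w \<in> weights" and Q: "Q \<in> cubes"
begin

definition "wQ x = w x * indicator Q x"
definition "L = measure lebesgue Q"
definition "W = rearrangement wQ"

lemma cube_obtain:
  obtains a l where "0 < l" "Q = cbox a (a + (\<chi> i. l))" "L = l ^ CARD('n)"
    "emeasure lebesgue Q = ennreal L"
proof -
  obtain a b l where *: "0 < l" "Q = cbox a b" "\<And>i. b $ i = a $ i + l"
    using Q by (auto simp: cubes_def)
  then have "b = a + (\<chi> i. l)" by (simp add: vec_eq_iff)
  with *(2) have Q': "Q = cbox a (a + (\<chi> i. l))" by simp
  have "L = l ^ CARD('n)" "emeasure lebesgue Q = ennreal (l ^ CARD('n))"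
    unfolding L_def unfolding *(2) by (simp_all only: measure_cube[OF *(1,3)])
  then show thesis
    by (intro that[OF *(1) Q']) simp_all
qed

lemma L_pos: "0 < L"
  by (rule cube_obtain) simp

lemma emeasure_Q: "emeasure lebesgue Q = ennreal L"
  by (rule cube_obtain) simp

lemma Q_sets [measurable]: "Q \<in> sets lebesgue"
  by (rule cube_obtain) simp

lemma integrable_wQ: "integrable lebesgue wQ"
proof -
  have "compact Q" by (rule cube_obtain) (simp add: compact_cbox)
  then have "set_integrable lebesgue Q w" using w by (simp add: weights_def)
  then show ?thesis by (simp add: set_integrable_def wQ_def[abs_def] mult.commute)
qed

lemma wQ_measurable [measurable]: "wQ \<in> borel_measurable lebesgue"
  using integrable_wQ by (rule borel_measurable_integrable)

lemma wQ_pos: "AE x in lebesgue. x \<in> Q \<longrightarrow> 0 < wQ x"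
  using w by (auto simp: weights_def wQ_def elim!: eventually_mono)

lemma wQ_nonneg: "AE x in lebesgue. 0 \<le> wQ x"
  using wQ_pos by eventually_elim (auto simp: wQ_def)

lemma W_nonneg: "0 < u \<Longrightarrow> 0 \<le> W u"
  unfolding W_def by (rule rearrangement_nonneg[OF integrable_wQ])

lemma W_antimono: "0 < u \<Longrightarrow> u \<le> v \<Longrightarrow> W v \<le> W u"
  unfolding W_def by (rule rearrangement_antimono[OF integrable_wQ])

lemma W_measurable: "(\<lambda>u. W u * indicator {0<..<s} u) \<in> borel_measurable borel"
proof -
  have "(\<lambda>u. W u * indicator {0<..<s} u) = (\<lambda>u. (if 0 < u then W u else 0) * indicator {0<..<s} u)"
    by (auto simp: indicator_def)
  then show ?thesis
    using borel_measurable_times[OF rearrangement_measurable[OF integrable_wQ] borel_measurable_indicator[of "{0<..<s}"]]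
    by (simp only: W_def) simp
qed

lemma W_pos:
  assumes "0 < u" "u < L"
  shows "0 < W u"
proof -
  have "ennreal u < ennreal L" using assms by (simp add: ennreal_less_iff)
  also have "ennreal L = emeasure lebesgue Q" by (simp add: emeasure_Q)
  also have "\<dots> \<le> emeasure lebesgue {x. 0 < \<bar>wQ x\<bar>}"
  proof (rule emeasure_mono_AE)
    show "AE x in lebesgue. x \<in> Q \<longrightarrow> x \<in> {x. 0 < \<bar>wQ x\<bar>}"
      using wQ_pos by eventually_elim auto
    have "{x \<in> space lebesgue. 0 < \<bar>wQ x\<bar>} \<in> sets lebesgue" by measurable
    then show "{x. 0 < \<bar>wQ x\<bar>} \<in> sets lebesgue" by simp
  qed
  finally show ?thesis
    unfolding W_def using rearrangement_gt_iff[OF integrable_wQ assms(1), of 0] by simp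
qed

lemma nn_integral_W:
  assumes "F \<in> borel_measurable borel"
  shows "(\<integral>\<^sup>+u\<in>{0<..<L}. F (W u) \<partial>lborel) = (\<integral>\<^sup>+x\<in>Q. F (wQ x) \<partial>lebesgue)"
  unfolding W_def
  by (rule nn_integral_rearrangement[OF integrable_wQ Q_sets emeasure_Q L_pos wQ_pos _ assms, symmetric])
    (simp add: wQ_def)

lemma nn_integral_W_total: "(\<integral>\<^sup>+u\<in>{0<..<L}. ennreal (W u) \<partial>lborel) = ennreal (LINT x:Q|lebesgue. w x)"
proof -
  have "(\<integral>\<^sup>+u\<in>{0<..<L}. ennreal (W u) \<partial>lborel) = (\<integral>\<^sup>+x\<in>Q. ennreal (wQ x) \<partial>lebesgue)"
    by (rule nn_integral_W) simp
  also have "\<dots> = (\<integral>\<^sup>+x. ennreal (wQ x) \<partial>lebesgue)"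
    by (intro nn_integral_cong) (auto simp: indicator_def wQ_def)
  also have "\<dots> = ennreal (integral\<^sup>L lebesgue wQ)"
    by (rule nn_integral_eq_integral[OF integrable_wQ wQ_nonneg])
  also have "integral\<^sup>L lebesgue wQ = (LINT x:Q|lebesgue. w x)"
    unfolding set_lebesgue_integral_def wQ_def by (simp add: mult.commute)
  finally show ?thesis .
qed

lemma set_integrable_W: 
  assumes "s \<le> L"
  shows "set_integrable lborel {0<..<s} W"
proof -
  have "integrable lborel (\<lambda>u. W u * indicator {0<..<L} u)"
  proof (rule integrableI_nonneg)
    show "(\<lambda>u. W u * indicator {0<..<L} u) \<in> borel_measurable lborel"
      using W_measurable by simp
    show "AE u in lborel. 0 \<le> W u * indicator {0<..<L} u"
      using W_nonneg by (intro AE_I2) (auto simp: indicator_def)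
    have "(\<integral>\<^sup>+u. ennreal (W u * indicator {0<..<L} u) \<partial>lborel) = (\<integral>\<^sup>+u\<in>{0<..<L}. ennreal (W u) \<partial>lborel)"
      by (intro nn_integral_cong) (auto simp: indicator_def)
    then show "(\<integral>\<^sup>+u. ennreal (W u * indicator {0<..<L} u) \<partial>lborel) < \<infinity>"
      by (simp add: nn_integral_W_total)
  qed
  then have "set_integrable lborel {0<..<L} W"
    by (simp add: set_integrable_def mult.commute)
  then show ?thesis
    by (rule set_integrable_subset) (use assms in auto)
qed

lemma phi_eq: "phi w Q s = (LINT u:{0<..<s}|lborel. W u)"
  by (simp add: phi_def W_def wQ_def[abs_def])

lemma phi_nn:
  assumes "s \<le> L"
  shows "(\<integral>\<^sup>+u\<in>{0<..<s}. ennreal (W u) \<partial>lborel) = ennreal (phi w Q s)"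
proof -
  have "(\<integral>\<^sup>+u\<in>{0<..<s}. ennreal (W u) \<partial>lborel) = (\<integral>\<^sup>+u. ennreal (indicator {0<..<s} u * W u) \<partial>lborel)"
    by (intro nn_integral_cong) (auto simp: indicator_def)
  also have "\<dots> = ennreal (LINT u|lborel. indicator {0<..<s} u * W u)"
    using set_integrable_W[OF assms] W_nonneg
    by (intro nn_integral_eq_integral) (auto simp: set_integrable_def indicator_def)
  finally show ?thesis by (simp add: phi_eq set_lebesgue_integral_def)
qed

lemma phi_nonneg: "0 \<le> phi w Q s"
  unfolding phi_eq set_lebesgue_integral_def using W_nonneg
  by (intro integral_nonneg_AE AE_I2) (auto simp: indicator_def)

lemma integral_w_eq_phi: "(LINT x:Q|lebesgue. w x) = phi w Q L"
proof -
  have "0 \<le> integral\<^sup>L lebesgue wQ" using wQ_nonneg by (rule integral_nonneg_AE)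
  moreover have "integral\<^sup>L lebesgue wQ = (LINT x:Q|lebesgue. w x)"
    unfolding set_lebesgue_integral_def wQ_def by (simp add: mult.commute)
  ultimately show ?thesis
    using phi_nn[of L] nn_integral_W_total phi_nonneg[of L] by simp
qed

lemma avg_eq_phi: "avg Q w = phi w Q L / L"
  by (simp add: avg_def integral_w_eq_phi L_def)

lemma phi_split:
  assumes "0 < s" "s \<le> t" "t \<le> L"
  shows "phi w Q t = phi w Q s + (LINT u:{s..<t}|lborel. W u)"
proof -
  have "{0<..<t} = {0<..<s} \<union> {s..<t}" using assms by auto
  then show ?thesis
    unfolding phi_eq using assms set_integrable_W[OF assms(3)]
    by (simp only:) (intro set_integral_Un; auto elim!: set_integrable_subset)
qed

lemma W_int_bounds:
  assumes "0 < s" "s \<le> t" "t \<le> L"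
  shows "(LINT u:{s..<t}|lborel. W u) \<le> (t - s) * W s"
    "0 \<le> (LINT u:{s..<t}|lborel. W u)"
proof -
  have int: "set_integrable lborel {s..<t} W"
    using set_integrable_W[OF assms(3)] by (rule set_integrable_subset) (use assms in auto)
  have "(LINT u:{s..<t}|lborel. W u) \<le> (LINT u:{s..<t}|lborel. W s)"
    using assms W_antimono by (intro set_integral_mono int) (auto simp: set_integrable_def)
  also have "\<dots> = (t - s) * W s"
    using assms by (simp add: set_lebesgue_integral_def)
  finally show "(LINT u:{s..<t}|lborel. W u) \<le> (t - s) * W s" .
  show "0 \<le> (LINT u:{s..<t}|lborel. W u)"
    unfolding set_lebesgue_integral_def using W_nonneg assms
    by (intro integral_nonneg_AE AE_I2) (auto simp: indicator_def)
qed

lemma phi_mono: "0 < s \<Longrightarrow> s \<le> t \<Longrightarrow> t \<le> L \<Longrightarrow> phi w Q s \<le> phi w Q t"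
  using phi_split[of s t] W_int_bounds(2)[of s t] by simp

lemma W_le_phi:
  assumes "0 < s" "s \<le> L"
  shows "s * W s \<le> phi w Q s"
proof -
  have "s * W s = (LINT u:{0<..<s}|lborel. W s)"
    using assms by (simp add: set_lebesgue_integral_def)
  also have "\<dots> \<le> (LINT u:{0<..<s}|lborel. W u)"
    using assms W_antimono by (intro set_integral_mono set_integrable_W) (auto simp: set_integrable_def)
  finally show ?thesis by (simp add: phi_eq)
qed

lemma phi_pos:
  assumes "0 < s" "s \<le> L"
  shows "0 < phi w Q s"
proof -
  have "0 < s / 2 * W (s / 2)" using W_pos[of "s/2"] assms by simp
  also have "\<dots> \<le> phi w Q (s / 2)" using assms by (intro W_le_phi) auto
  also have "\<dots> \<le> phi w Q s" using assms by (intro phi_mono) auto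
  finally show ?thesis .
qed

text \<open>
  The mean \<open>\<phi>(s)/s\<close> of a nonincreasing function over \<open>(0, s)\<close> is nonincreasing in \<open>s\<close>. In particular
  \<open>\<phi>(t)/t\<close> is at least the average of \<open>w\<close> over \<open>Q\<close>, so the decomposition can be made at that height.
\<close>

lemma phi_div_antimono:
  assumes "0 < s" "s \<le> t" "t \<le> L"
  shows "phi w Q t / t \<le> phi w Q s / s"
proof -
  have "phi w Q t \<le> phi w Q s + (t - s) * W s"
    using phi_split[OF assms] W_int_bounds(1)[OF assms] by simp
  then have "s * phi w Q t \<le> s * phi w Q s + (t - s) * (s * W s)"
    using assms by (auto dest: mult_left_mono[of _ _ s] simp: algebra_simps)
  also have "\<dots> \<le> s * phi w Q s + (t - s) * phi w Q s"
    using assms W_le_phi[of s] by (intro add_left_mono mult_left_mono) auto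
  finally have "s * phi w Q t \<le> t * phi w Q s" by (simp add: algebra_simps)
  then show ?thesis using assms by (simp add: field_simps)
qed

end

context weight_on_cube
begin

text \<open>
  A form of \<open>\<integral>\<^sub>A w \<le> \<phi>(t) + W(t) (|A| - t)\<close> without subtraction. It holds since
  \<open>w \<le> W(t) + (w - W(t))\<^sup>+\<close>, and the integral of the positive part over \<open>Q\<close> is, by
  equimeasurability, \<open>\<phi>(t) - t W(t)\<close>.
\<close>

lemma nn_integral_subset_bound:
  assumes A[measurable]: "A \<in> sets lebesgue" and t: "0 < t" "t \<le> L"
  shows "(\<integral>\<^sup>+x\<in>A. ennreal (wQ x) \<partial>lebesgue) + ennreal (t * W t)
    \<le> ennreal (W t) * emeasure lebesgue A + ennreal (phi w Q t)"
proof -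
  define G where "G v = ennreal (max 0 (v - W t))" for v
  have Gm[measurable]: "G \<in> borel_measurable borel" unfolding G_def by measurable
  have Wt: "0 \<le> W t" using W_nonneg t by simp
  have "(\<integral>\<^sup>+x\<in>A. ennreal (wQ x) \<partial>lebesgue)
      \<le> (\<integral>\<^sup>+x. ennreal (W t) * indicator A x + G (wQ x) * indicator Q x \<partial>lebesgue)"
  proof (rule nn_integral_mono)
    fix x
    show "ennreal (wQ x) * indicator A x \<le> ennreal (W t) * indicator A x + G (wQ x) * indicator Q x"
    proof (cases "x \<in> A \<inter> Q")
      case True
      have "ennreal (wQ x) \<le> ennreal (W t + max 0 (wQ x - W t))" by (intro ennreal_leI) simp
      also have "\<dots> = ennreal (W t) + G (wQ x)" using Wt by (simp add: G_def ennreal_plus)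
      finally show ?thesis using True by simp
    next
      case False
      then show ?thesis by (auto simp: indicator_def wQ_def)
    qed
  qed
  also have "\<dots> = ennreal (W t) * emeasure lebesgue A + (\<integral>\<^sup>+x\<in>Q. G (wQ x) \<partial>lebesgue)"
    by (subst nn_integral_add) (auto simp: nn_integral_cmult_indicator)
  also have "(\<integral>\<^sup>+x\<in>Q. G (wQ x) \<partial>lebesgue) = (\<integral>\<^sup>+u\<in>{0<..<L}. G (W u) \<partial>lborel)"
    by (rule nn_integral_W[OF Gm, symmetric])
  finally have 1: "(\<integral>\<^sup>+x\<in>A. ennreal (wQ x) \<partial>lebesgue)
      \<le> ennreal (W t) * emeasure lebesgue A + (\<integral>\<^sup>+u\<in>{0<..<L}. G (W u) \<partial>lborel)" .
  have GW: "(\<lambda>u. G (W u) * indicator {0<..<L} u) \<in> borel_measurable lborel"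
  proof -
    have "(\<lambda>u. G (W u) * indicator {0<..<L} u) = (\<lambda>u. G (W u * indicator {0<..<L} u) * indicator {0<..<L} u)"
      by (auto simp: indicator_def)
    then show ?thesis using W_measurable[of L] by simp
  qed
  have "(\<integral>\<^sup>+u\<in>{0<..<L}. G (W u) \<partial>lborel) + ennreal (t * W t)
      = (\<integral>\<^sup>+u\<in>{0<..<L}. G (W u) \<partial>lborel) + (\<integral>\<^sup>+u. ennreal (W t) * indicator {0<..<t} u \<partial>lborel)"
    using t Wt by (simp add: nn_integral_cmult_indicator ennreal_mult mult.commute)
  also have "\<dots> = (\<integral>\<^sup>+u. G (W u) * indicator {0<..<L} u + ennreal (W t) * indicator {0<..<t} u \<partial>lborel)"
    using GW by (subst nn_integral_add) auto
  also have "\<dots> \<le> (\<integral>\<^sup>+u\<in>{0<..<t}. ennreal (W u) \<partial>lborel)"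
  proof (rule nn_integral_mono)
    fix u
    consider "u \<in> {0<..<t}" | "u \<in> {t..<L}" | "u \<notin> {0<..<L}" using t by fastforce
    then show "G (W u) * indicator {0<..<L} u + ennreal (W t) * indicator {0<..<t} u
        \<le> ennreal (W u) * indicator {0<..<t} u"
    proof cases
      case 1
      then have "W t \<le> W u" by (intro W_antimono) auto
      then have "G (W u) + ennreal (W t) = ennreal (W u)"
        using Wt by (simp add: G_def flip: ennreal_plus)
      then show ?thesis using 1 t by simp
    next
      case 2
      then have "W u \<le> W t" using t by (intro W_antimono) auto
      then have "G (W u) = 0" by (simp add: G_def)
      then show ?thesis using 2 by simp
    next
      case 3
      then show ?thesis using t by (auto simp: indicator_def)
    qed
  qed
  also have "\<dots> = ennreal (phi w Q t)" by (rule phi_nn[OF t(2)])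
  finally have 2: "(\<integral>\<^sup>+u\<in>{0<..<L}. G (W u) \<partial>lborel) + ennreal (t * W t) \<le> ennreal (phi w Q t)" .
  show ?thesis
    using add_right_mono[OF 1, of "ennreal (t * W t)"] add_left_mono[OF 2, of "ennreal (W t) * emeasure lebesgue A"]
    by (simp only: add.assoc order_trans)
qed

text \<open>
  If \<open>|A| > t\<close>, the previous bound and \<open>W(t) \<le> \<phi>(t)/t\<close> give \<open>\<integral>\<^sub>A w \<le> |A| \<phi>(t)/t\<close>. The factor 2
  in the hypothesis makes this a contradiction.
\<close>

lemma emeasure_le_of_average_gt:
  assumes A[measurable]: "A \<in> sets lebesgue" "A \<subseteq> Q" and t: "0 < t" "t \<le> L"
    and avg: "ennreal (2 * (phi w Q t / t)) * emeasure lebesgue A \<le> (\<integral>\<^sup>+x\<in>A. ennreal (wQ x) \<partial>lebesgue)"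
  shows "emeasure lebesgue A \<le> ennreal t"
proof -
  define lam where "lam = phi w Q t / t"
  have lam: "0 < lam" "phi w Q t = lam * t" using phi_pos[OF t] t by (simp_all add: lam_def)
  have Wt: "0 \<le> W t" "W t \<le> lam"
    using W_nonneg t W_le_phi[OF t] by (auto simp: lam_def field_simps)
  have "emeasure lebesgue A \<le> emeasure lebesgue Q" using A by (intro emeasure_mono) auto
  then obtain \<alpha> where \<alpha>: "emeasure lebesgue A = ennreal \<alpha>" "0 \<le> \<alpha>"
    unfolding emeasure_Q by (cases "emeasure lebesgue A") (auto simp: top_unique)
  have "ennreal (2 * lam * \<alpha> + t * W t) = ennreal (2 * lam) * emeasure lebesgue A + ennreal (t * W t)"
    using \<alpha> lam t Wt by (simp add: ennreal_mult ennreal_plus)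
  also have "\<dots> \<le> (\<integral>\<^sup>+x\<in>A. ennreal (wQ x) \<partial>lebesgue) + ennreal (t * W t)"
    using avg by (intro add_right_mono) (simp add: lam_def)
  also have "\<dots> \<le> ennreal (W t) * emeasure lebesgue A + ennreal (phi w Q t)"
    by (rule nn_integral_subset_bound[OF A(1) t])
  also have "\<dots> = ennreal (W t * \<alpha> + lam * t)"
    using \<alpha> lam t Wt by (simp add: ennreal_mult ennreal_plus)
  finally have "2 * lam * \<alpha> + t * W t \<le> W t * \<alpha> + lam * t"
    using \<alpha> lam t Wt by (subst (asm) ennreal_le_iff) auto
  then have *: "2 * lam * \<alpha> \<le> W t * (\<alpha> - t) + lam * t" by (simp add: algebra_simps)
  have "\<alpha> \<le> t"
  proof (rule ccontr)
    assume "\<not> \<alpha> \<le> t"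
    then have "W t * (\<alpha> - t) \<le> lam * (\<alpha> - t)" using Wt by (intro mult_right_mono) auto
    with * have "lam * \<alpha> \<le> 0" by (simp add: algebra_simps)
    moreover have "0 < lam * \<alpha>" using lam t \<open>\<not> \<alpha> \<le> t\<close> by simp
    ultimately show False by simp
  qed
  then show ?thesis using \<alpha> by (simp add: ennreal_leI)
qed

lemma nn_integral_wQ_eq_avg:
  assumes P: "P \<in> cubes" "P \<subseteq> Q"
  shows "(\<integral>\<^sup>+x\<in>P. ennreal (wQ x) \<partial>lebesgue) = ennreal (avg P w) * emeasure lebesgue P"
proof -
  interpret P: weight_on_cube w P using w P by unfold_locales
  have "(\<integral>\<^sup>+x\<in>P. ennreal (wQ x) \<partial>lebesgue) = (\<integral>\<^sup>+x\<in>P. ennreal (P.wQ x) \<partial>lebesgue)"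
    using P(2) by (intro nn_integral_cong) (auto simp: indicator_def wQ_def P.wQ_def)
  also have "\<dots> = (\<integral>\<^sup>+u\<in>{0<..<P.L}. ennreal (P.W u) \<partial>lborel)"
    by (rule P.nn_integral_W[symmetric]) simp
  also have "\<dots> = ennreal (phi w P P.L)" by (rule P.phi_nn) simp
  also have "phi w P P.L = avg P w * P.L" using P.L_pos by (simp add: P.avg_eq_phi)
  also have "ennreal (avg P w * P.L) = ennreal (avg P w) * emeasure lebesgue P"
    unfolding P.emeasure_Q using P.L_pos P.phi_nonneg[of P.L]
    by (intro ennreal_mult) (auto simp: P.avg_eq_phi)
  finally show ?thesis .
qed

text \<open>
  The passage from cubes to rearrangements: a bound for \<open>F(w)\<close> on those subcubes where the average of
  \<open>w\<close> is controlled by \<open>\<phi>(t)/t\<close> bounds the upper part of the distribution of \<open>F(w)\<close> on \<open>Q\<close>.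
\<close>

lemma level_set_bound:
  fixes F :: "real \<Rightarrow> ennreal"
  assumes t: "0 < t" "t \<le> L" and F[measurable]: "F \<in> borel_measurable borel"
    and cubes: "\<And>P. P \<in> cubes \<Longrightarrow> P \<subseteq> Q \<Longrightarrow> avg P w \<le> 2 ^ CARD('n) * (2 * (phi w Q t / t)) \<Longrightarrow>
      (\<integral>\<^sup>+x\<in>P. F (w x) \<partial>lebesgue) \<le> c * emeasure lebesgue P"
  shows "(\<integral>\<^sup>+u\<in>{0<..<L}. (if 2 * (phi w Q t / t) < W u then F (W u) else 0) \<partial>lborel) \<le> c * ennreal t"
proof -
  define lam where "lam = 2 * (phi w Q t / t)"
  have lam: "0 < lam" using phi_pos[OF t] t by (simp add: lam_def)
  define \<nu> where "\<nu> = density lebesgue (\<lambda>x. ennreal (wQ x))"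
  define \<mu> where "\<mu> = density lebesgue (\<lambda>x. F (wQ x))"
  have \<nu>: "emeasure \<nu> A = (\<integral>\<^sup>+x\<in>A. ennreal (wQ x) \<partial>lebesgue)" if "A \<in> sets lebesgue" for A
    using that unfolding \<nu>_def by (subst emeasure_density) auto
  have \<mu>: "emeasure \<mu> A = (\<integral>\<^sup>+x\<in>A. F (wQ x) \<partial>lebesgue)" if "A \<in> sets lebesgue" for A
    using that unfolding \<mu>_def by (subst emeasure_density) auto
  obtain a l where al: "0 < l" "Q = cbox a (a + (\<chi> i. l))" by (rule cube_obtain)
  have "emeasure \<nu> Q = ennreal (avg Q w) * emeasure lebesgue Q"
    using \<nu>[OF Q_sets] nn_integral_wQ_eq_avg[OF Q] by simp
  also have "\<dots> \<le> ennreal lam * emeasure lebesgue Q"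
  proof (intro mult_right_mono ennreal_leI)
    have "avg Q w \<le> phi w Q t / t"
      unfolding avg_eq_phi using t by (intro phi_div_antimono) auto
    then show "avg Q w \<le> lam" using lam unfolding lam_def by linarith
  qed simp
  finally have avg: "emeasure \<nu> Q \<le> ennreal lam * emeasure lebesgue Q" .
  obtain \<F> where \<F>: "countable \<F>" "disjoint \<F>" "\<And>P. P \<in> \<F> \<Longrightarrow> P \<in> sets lebesgue" "\<Union>\<F> \<subseteq> Q"
    "\<And>P. P \<in> \<F> \<Longrightarrow> ennreal lam * emeasure lebesgue P \<le> emeasure \<nu> P"
    "\<And>P. P \<in> \<F> \<Longrightarrow> \<exists>P'\<in>cubes. P \<subseteq> P' \<and> P' \<subseteq> Q \<and> negligible (P' - P) \<and>
        emeasure \<nu> P' \<le> ennreal (2 ^ CARD('n) * lam) * emeasure lebesgue P'"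
    "AE x in lebesgue. x \<in> Q - \<Union>\<F> \<longrightarrow> wQ x \<le> lam"
    using calderon_zygmund[OF al(1) less_imp_le[OF lam] wQ_measurable al(2) avg[unfolded \<nu>_def]]
    unfolding \<nu>_def by blast
  define A where "A = \<Union>\<F>"
  have A[measurable]: "A \<in> sets lebesgue" unfolding A_def using \<F>(1,3) by blast
  have "ennreal lam * emeasure lebesgue A \<le> emeasure \<nu> A"
  proof -
    have "emeasure (density lebesgue (\<lambda>_. ennreal lam)) (\<Union>\<F>) \<le> 1 * emeasure \<nu> (\<Union>\<F>)"
    proof (rule emeasure_Union_le[OF \<F>(1,2)])
      fix P assume P: "P \<in> \<F>"
      then show "emeasure (density lebesgue (\<lambda>_. ennreal lam)) P \<le> 1 * emeasure \<nu> P"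
        using \<F>(3,5)[OF P] by (simp add: emeasure_density_const)
    qed (use \<F>(3) in \<open>auto simp: \<nu>_def\<close>)
    then show ?thesis using A by (simp add: A_def emeasure_density_const)
  qed
  then have At: "emeasure lebesgue A \<le> ennreal t"
    using \<nu>[OF A] \<F>(4) unfolding lam_def
    by (intro emeasure_le_of_average_gt[OF A _ t]) (auto simp: A_def)
  have PF: "emeasure \<mu> P \<le> c * emeasure lebesgue P" if P: "P \<in> \<F>" for P
  proof -
    obtain P' where P': "P' \<in> cubes" "P \<subseteq> P'" "P' \<subseteq> Q" "negligible (P' - P)"
        "emeasure \<nu> P' \<le> ennreal (2 ^ CARD('n) * lam) * emeasure lebesgue P'"
      using \<F>(6)[OF P] by blast
    interpret P': weight_on_cube w P' using w P' by unfold_locales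
    have "ennreal (avg P' w) * ennreal P'.L \<le> ennreal (2 ^ CARD('n) * lam) * ennreal P'.L"
      using P'(5) \<nu>[OF P'.Q_sets] nn_integral_wQ_eq_avg[OF P'(1,3)] by (simp add: P'.emeasure_Q)
    then have "ennreal (avg P' w * P'.L) \<le> ennreal (2 ^ CARD('n) * lam * P'.L)"
      using P'.L_pos lam P'.phi_nonneg[of P'.L] by (subst (1 2) ennreal_mult) (auto simp: P'.avg_eq_phi)
    then have "avg P' w * P'.L \<le> 2 ^ CARD('n) * lam * P'.L"
      using P'.L_pos lam by (subst (asm) ennreal_le_iff) auto
    then have "avg P' w \<le> 2 ^ CARD('n) * lam"
      using P'.L_pos by (simp add: mult_le_cancel_right)
    then have "(\<integral>\<^sup>+x\<in>P'. F (w x) \<partial>lebesgue) \<le> c * emeasure lebesgue P'"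
      using cubes[OF P'(1,3)] by (simp add: lam_def)
    moreover have "(\<integral>\<^sup>+x\<in>P'. F (w x) \<partial>lebesgue) = emeasure \<mu> P'"
      using P'(3) by (subst \<mu>[OF P'.Q_sets], intro nn_integral_cong) (auto simp: indicator_def wQ_def)
    moreover have "emeasure \<mu> P \<le> emeasure \<mu> P'"
      using P'(2) P'.Q_sets by (intro emeasure_mono) (auto simp: \<mu>_def)
    moreover have "emeasure lebesgue P' = emeasure lebesgue P"
    proof (rule emeasure_eq_AE)
      show "AE x in lebesgue. (x \<in> P') = (x \<in> P)"
        using P'(2,4) by (auto simp: negligible_iff_null_sets elim!: AE_not_in[THEN eventually_mono])
    qed (use \<F>(3) P P'.Q_sets in auto)
    ultimately show ?thesis by simp
  qed
  define G where "G v = (if lam < v then F v else 0)" for v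
  have [measurable]: "G \<in> borel_measurable borel" unfolding G_def by measurable
  have "(\<integral>\<^sup>+u\<in>{0<..<L}. G (W u) \<partial>lborel) = (\<integral>\<^sup>+x\<in>Q. G (wQ x) \<partial>lebesgue)"
    by (rule nn_integral_W) measurable
  also have "\<dots> \<le> (\<integral>\<^sup>+x\<in>A. F (wQ x) \<partial>lebesgue)"
  proof (rule nn_integral_mono_AE)
    show "AE x in lebesgue. G (wQ x) * indicator Q x \<le> F (wQ x) * indicator A x"
      using \<F>(7) by eventually_elim (auto simp: G_def indicator_def A_def)
  qed
  also have "\<dots> = emeasure \<mu> (\<Union>\<F>)" using \<mu>[OF A] by (simp add: A_def)
  also have "\<dots> \<le> c * emeasure lebesgue (\<Union>\<F>)"
    by (rule emeasure_Union_le[OF \<F>(1,2,3) _ PF]) (auto simp: \<mu>_def)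
  also have "\<dots> \<le> c * ennreal t" using At unfolding A_def by (rule mult_left_mono) simp
  finally show ?thesis by (simp add: G_def lam_def)
qed

end

section \<open>Jensen's inequality and geometric decay\<close>

text \<open>
  Young's inequality for the product of \<open>g\<close> and the power \<open>A\<^bsup>p-1\<^esup>\<close> of its mean \<open>A\<close>, integrated
  over \<open>S\<close>.
\<close>

lemma jensen_powr:
  fixes g :: "'a \<Rightarrow> real"
  assumes p: "1 < p" and S: "S \<in> sets M" "emeasure M S = ennreal m" "0 < m"
    and g: "set_integrable M S g" "set_integrable M S (\<lambda>x. g x powr p)" "\<And>x. x \<in> S \<Longrightarrow> 0 \<le> g x"
  shows "(LINT x:S|M. g x) powr p \<le> m powr (p - 1) * (LINT x:S|M. g x powr p)"
proof -
  define I where "I = (LINT x:S|M. g x)"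
  define J where "J = (LINT x:S|M. g x powr p)"
  have J: "0 \<le> J" unfolding J_def set_lebesgue_integral_def
    by (intro integral_nonneg_AE AE_I2) (auto simp: indicator_def)
  have I: "0 \<le> I" unfolding I_def set_lebesgue_integral_def
    using g(3) by (intro integral_nonneg_AE AE_I2) (auto simp: indicator_def)
  show ?thesis
  proof (cases "I = 0")
    case True
    then show ?thesis using J S(3) by (simp add: I_def[symmetric] J_def[symmetric])
  next
    case False
    define A where "A = I / m"
    have A: "0 < A" "I = m * A" using I False S(3) by (simp_all add: A_def)
    define q where "q = p / (p - 1)"
    have q: "1 < q" "1 / p + 1 / q = 1" "(p - 1) * q = p"
      using p by (simp_all add: q_def field_simps)
    have const: "set_integrable M S (\<lambda>_. c)" for c :: real
      using S by (simp add: set_integrable_def)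
    have "I * A powr (p - 1) = (LINT x:S|M. g x * A powr (p - 1))"
      by (simp add: I_def)
    also have "\<dots> \<le> (LINT x:S|M. g x powr p / p + A powr p / q)"
    proof (intro set_integral_mono)
      show "set_integrable M S (\<lambda>x. g x * A powr (p - 1))" using g(1) by simp
      show "set_integrable M S (\<lambda>x. g x powr p / p + A powr p / q)"
        using g(2) const by (intro set_integral_add) auto
      fix x assume "x \<in> S"
      then show "g x * A powr (p - 1) \<le> g x powr p / p + A powr p / q"
        using Youngs_inequality[OF p q(1,2), of "g x" "A powr (p - 1)"] g(3)
        by (simp add: powr_powr q(3))
    qed
    also have "\<dots> = J / p + m * (A powr p / q)"
      using g(2) const S by (subst set_integral_add) (auto simp: J_def set_lebesgue_integral_def measure_def)
    finally have "I * A powr (p - 1) \<le> J / p + m * (A powr p / q)" .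
    moreover have "I * A powr (p - 1) = m * A powr p"
      using A by (simp add: powr_diff)
    moreover have "m * (A powr p / q) = m * A powr p - m * A powr p / p"
    proof -
      have "1 / q = 1 - 1 / p" using q(2) by simp
      then have "m * A powr p * (1 / q) = m * A powr p * (1 - 1 / p)" by simp
      then show ?thesis by (simp add: algebra_simps)
    qed
    ultimately have "m * A powr p / p \<le> J / p" by simp
    then have "m * A powr p \<le> J" using p by (simp add: divide_le_cancel)
    then have "m powr (p - 1) * (m * A powr p) \<le> m powr (p - 1) * J" by (intro mult_left_mono) auto
    moreover have "m powr (p - 1) * (m * A powr p) = I powr p"
      using A S(3) by (simp add: powr_mult powr_diff)
    ultimately show ?thesis by (simp add: I_def J_def)
  qed
qed

text \<open>
  Compare \<open>s\<close> with the powers \<open>\<epsilon>\<^sup>k t\<close>. The exponent \<open>\<delta> = ln \<eta> / ln \<epsilon>\<close> is the one with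
  \<open>\<epsilon>\<^sup>\<delta> = \<eta>\<close>, and the factor \<open>1/\<eta>\<close> pays for rounding \<open>k\<close>.
\<close>

lemma geometric_decay:
  fixes H :: "real \<Rightarrow> real"
  assumes \<epsilon>: "0 < \<epsilon>" "\<epsilon> < 1" and \<eta>: "0 < \<eta>" "\<eta> < 1"
    and mono: "\<And>s t. 0 < s \<Longrightarrow> s \<le> t \<Longrightarrow> t \<le> L \<Longrightarrow> H s \<le> H t"
    and nonneg: "\<And>s. 0 < s \<Longrightarrow> s \<le> L \<Longrightarrow> 0 \<le> H s"
    and step: "\<And>t. 0 < t \<Longrightarrow> t \<le> L \<Longrightarrow> H (\<epsilon> * t) \<le> \<eta> * H t"
    and st: "0 < s" "s \<le> t" "t \<le> L"
  shows "H s \<le> 1 / \<eta> * (s / t) powr (ln \<eta> / ln \<epsilon>) * H t"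
proof -
  define \<delta> where "\<delta> = ln \<eta> / ln \<epsilon>"
  have \<delta>: "0 < \<delta>" using \<epsilon> \<eta> by (simp add: \<delta>_def divide_neg_neg)
  have \<epsilon>\<delta>: "\<epsilon> powr \<delta> = \<eta>" using \<epsilon> \<eta> by (simp add: \<delta>_def powr_def)
  define k where "k = nat \<lfloor>ln (s / t) / ln \<epsilon>\<rfloor>"
  have "0 \<le> ln (s / t) / ln \<epsilon>"
    using st \<epsilon> by (intro divide_nonpos_neg) auto
  then have k: "real k \<le> ln (s / t) / ln \<epsilon>" "ln (s / t) / ln \<epsilon> < real k + 1"
    by (simp_all add: k_def floor_less_iff)
  have "ln (s / t) \<le> real k * ln \<epsilon>" using k(1) \<epsilon> by (simp add: field_simps)
  then have "s / t \<le> \<epsilon> ^ k"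
    using st \<epsilon> by (subst ln_le_cancel_iff[symmetric]) (auto simp: ln_realpow)
  then have s1: "s \<le> \<epsilon> ^ k * t" using st by (simp add: field_simps)
  have "real (Suc k) * ln \<epsilon> \<le> ln (s / t)" using k(2) \<epsilon> by (simp add: field_simps)
  then have s2: "\<epsilon> ^ Suc k \<le> s / t"
    using st \<epsilon> by (subst ln_le_cancel_iff[symmetric]) (auto simp: ln_realpow simp del: power_Suc)
  have le: "\<epsilon> ^ j * t \<le> t" for j using \<epsilon> st by (simp add: mult_le_cancel_right1 power_le_one)
  have "H (\<epsilon> ^ j * t) \<le> \<eta> ^ j * H t" for j
  proof (induction j)
    case (Suc j)
    have "H (\<epsilon> * (\<epsilon> ^ j * t)) \<le> \<eta> * H (\<epsilon> ^ j * t)"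
      using st \<epsilon> order_trans[OF le[of j] st(3)] by (intro step) auto
    also have "\<dots> \<le> \<eta> * (\<eta> ^ j * H t)" using Suc \<eta> by (intro mult_left_mono) auto
    finally show ?case by (simp add: mult.assoc)
  qed simp
  then have "H s \<le> \<eta> ^ k * H t"
    using mono[OF st(1) s1] le[of k] st by (meson order_trans)
  also have "\<eta> ^ k = 1 / \<eta> * \<eta> ^ Suc k" using \<eta> by simp
  also have "\<eta> ^ Suc k = (\<epsilon> ^ Suc k) powr \<delta>"
  proof -
    have "(\<epsilon> powr \<delta>) ^ n = (\<epsilon> ^ n) powr \<delta>" for n
      using \<epsilon> by (induction n) (simp_all add: powr_mult)
    then show ?thesis by (simp only: \<epsilon>\<delta>)
  qed
  also have "1 / \<eta> * (\<epsilon> ^ Suc k) powr \<delta> * H t \<le> 1 / \<eta> * (s / t) powr \<delta> * H t"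
    using s2 \<delta> \<eta> \<epsilon> st nonneg[of t]
    by (intro mult_right_mono mult_left_mono powr_mono2) auto
  finally show ?thesis by (simp add: \<delta>_def)
qed

text \<open>
  Let \<open>c\<close> be the constant in \<open>\<phi>(s) \<ge> c s\<^bsup>1/p'\<^esup> \<Phi>(s)\<^bsup>1/p\<^esup>\<close>, the reverse inequality. Jensen's
  inequality on \<open>(0, \<epsilon>s)\<close> bounds \<open>\<phi>(\<epsilon>s)\<close> by \<open>\<epsilon>\<^bsup>1/p'\<^esup> s\<^bsup>1/p'\<^esup> \<Phi>(s)\<^bsup>1/p\<^esup>\<close>, and \<open>\<epsilon>\<close> is chosen so
  that this is at most half of the lower bound for \<open>\<phi>(s)\<close>. Then \<open>\<phi>(s) - \<phi>(\<epsilon>s)\<close> is still large, and Jensen's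
  inequality on \<open>(\<epsilon>s, s)\<close> makes \<open>\<Phi>(s) - \<Phi>(\<epsilon>s)\<close> a fixed fraction of \<open>\<Phi>(s)\<close>. The minimum with 1
  guarantees \<open>\<epsilon> < 1\<close>.
\<close>

lemma reverse_jensen_decay:
  fixes \<phi> \<Phi> :: "real \<Rightarrow> real"
  assumes p: "1 < p" and K: "0 < K"
    and c_def: "c = K powr (- 1 / p)"
    and \<epsilon>_def: "\<epsilon> = (min c 1 / 2) powr (p / (p - 1))"
    and s: "0 < s"
    and \<phi>0: "0 \<le> \<phi> (\<epsilon> * s)" and \<Phi>0: "0 \<le> \<Phi> (\<epsilon> * s)" "\<Phi> (\<epsilon> * s) \<le> \<Phi> s"
    and reverse: "\<Phi> s \<le> K * (s powr (1 - p) * \<phi> s powr p)" "0 \<le> \<phi> s"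
    and jensen1: "\<phi> (\<epsilon> * s) powr p \<le> (\<epsilon> * s) powr (p - 1) * \<Phi> (\<epsilon> * s)"
    and jensen2: "(\<phi> s - \<phi> (\<epsilon> * s)) powr p \<le> ((1 - \<epsilon>) * s) powr (p - 1) * (\<Phi> s - \<Phi> (\<epsilon> * s))"
    and diff: "\<phi> (\<epsilon> * s) \<le> \<phi> s"
  shows "\<Phi> (\<epsilon> * s) \<le> (1 - (min c 1 / 2) powr p) * \<Phi> s"
proof -
  define b where "b = min c 1 / 2"
  have "0 < c" using K by (simp add: c_def)
  then have b: "0 < b" "b < 1" "2 * b \<le> c" by (auto simp: b_def)
  have \<epsilon>: "0 < \<epsilon>" "\<epsilon> < 1" "\<epsilon> powr ((p - 1) / p) = b" 
  proof -
    show "0 < \<epsilon>" using b by (simp add: \<epsilon>_def b_def[symmetric])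
    show "\<epsilon> < 1" using b p powr_less_mono2[of "p / (p - 1)" b 1]
      by (simp add: \<epsilon>_def b_def[symmetric])
    show "\<epsilon> powr ((p - 1) / p) = b" using b p by (simp add: \<epsilon>_def b_def[symmetric] powr_powr)
  qed
  have root: "x \<le> y powr (1 / p)" if "x powr p \<le> y" "0 \<le> x" for x y :: real
  proof -
    have "x = (x powr p) powr (1 / p)" using that p by (simp add: powr_powr)
    also have "\<dots> \<le> y powr (1 / p)" using that p by (intro powr_mono2) auto
    finally show ?thesis .
  qed
  define X where "X = s powr ((p - 1) / p)"
  have X: "0 < X" using s by (simp add: X_def)
  have Xp: "X powr p = s powr (p - 1)" using p by (simp add: X_def powr_powr)
  define Y where "Y = \<Phi> s powr (1 / p)"
  have Y: "0 \<le> Y" "Y powr p = \<Phi> s" using \<Phi>0 p by (simp_all add: Y_def powr_powr)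
  have 1: "c * X * Y \<le> \<phi> s"
  proof -
    have "Y \<le> (K * (s powr (1 - p) * \<phi> s powr p)) powr (1 / p)"
      unfolding Y_def using reverse \<Phi>0 p by (intro powr_mono2) auto
    also have "\<dots> = K powr (1 / p) * (s powr ((1 - p) / p) * \<phi> s)"
      using K s reverse(2) p by (simp add: powr_mult powr_powr)
    also have "\<dots> = \<phi> s / (c * X)"
      using K s p by (simp add: c_def X_def powr_minus_divide minus_divide_left[symmetric] diff_divide_distrib powr_diff)
    finally show ?thesis using X \<open>0 < c\<close> by (simp add: field_simps)
  qed
  have 2: "\<phi> (\<epsilon> * s) \<le> b * X * Y"
  proof -
    have "\<phi> (\<epsilon> * s) \<le> ((\<epsilon> * s) powr (p - 1) * \<Phi> (\<epsilon> * s)) powr (1 / p)"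
      by (rule root[OF jensen1 \<phi>0])
    also have "\<dots> \<le> ((\<epsilon> * s) powr (p - 1) * \<Phi> s) powr (1 / p)"
      using \<Phi>0 p by (intro powr_mono2 mult_left_mono) auto
    also have "\<dots> = \<epsilon> powr ((p - 1) / p) * X * Y"
      using \<epsilon> s \<Phi>0 p by (simp add: X_def Y_def powr_mult powr_powr)
    finally show ?thesis using \<epsilon>(3) by simp
  qed
  have "b * X * Y \<le> \<phi> s - \<phi> (\<epsilon> * s)"
  proof -
    have "2 * b * (X * Y) \<le> c * (X * Y)" using b X Y by (intro mult_right_mono) auto
    then show ?thesis using 1 2 by (simp add: algebra_simps)
  qed
  then have "(b * X * Y) powr p \<le> (\<phi> s - \<phi> (\<epsilon> * s)) powr p"
    using b X Y p by (intro powr_mono2) auto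
  also have "\<dots> \<le> ((1 - \<epsilon>) * s) powr (p - 1) * (\<Phi> s - \<Phi> (\<epsilon> * s))" by (rule jensen2)
  also have "\<dots> \<le> s powr (p - 1) * (\<Phi> s - \<Phi> (\<epsilon> * s))"
    using \<epsilon> s p \<Phi>0 by (intro mult_right_mono powr_mono2) (auto simp: algebra_simps)
  finally have "s powr (p - 1) * (b powr p * \<Phi> s) \<le> s powr (p - 1) * (\<Phi> s - \<Phi> (\<epsilon> * s))"
    using b X Y by (simp add: powr_mult Xp mult_ac)
  then have "b powr p * \<Phi> s \<le> \<Phi> s - \<Phi> (\<epsilon> * s)"
    using s by (simp add: mult_le_cancel_left_pos)
  then show ?thesis by (simp add: b_def algebra_simps)
qed

section \<open>Reverse Hoelder weights\<close>

context weight_on_cube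
begin

lemma W_borel: "(\<lambda>u. F (W u) * indicator {0<..<s} u) \<in> borel_measurable lborel"
  if [measurable]: "F \<in> borel_measurable borel" for F :: "real \<Rightarrow> ennreal"
proof -
  have [measurable]: "(\<lambda>u. W u * indicator {0<..<s} u) \<in> borel_measurable borel" by (rule W_measurable)
  have "(\<lambda>u. F (W u) * indicator {0<..<s} u) = (\<lambda>u. F (W u * indicator {0<..<s} u) * indicator {0<..<s} u)"
    by (auto simp: indicator_def)
  then show ?thesis by simp
qed

text \<open>
  Splits \<open>\<integral>\<^sub>0\<^sup>t F(W)\<close> at the level \<open>lam\<close>, extending the upper part to all of \<open>(0, L)\<close>, which is where
  \<open>level_set_bound\<close> applies.
\<close>

lemma nn_integral_truncated:
  fixes F :: "real \<Rightarrow> ennreal" and h :: ennreal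
  assumes t: "0 < t" "t \<le> L" and F[measurable]: "F \<in> borel_measurable borel"
    and h: "\<And>v. v \<le> lam \<Longrightarrow> F v \<le> h"
  shows "(\<integral>\<^sup>+u\<in>{0<..<t}. F (W u) \<partial>lborel) \<le> h * ennreal t +
    (\<integral>\<^sup>+u\<in>{0<..<L}. (if lam < W u then F (W u) else 0) \<partial>lborel)"
proof -
  define G where "G v = (if lam < v then F v else 0)" for v
  have [measurable]: "G \<in> borel_measurable borel" unfolding G_def by measurable
  have "(\<integral>\<^sup>+u\<in>{0<..<t}. F (W u) \<partial>lborel) \<le>
      (\<integral>\<^sup>+u. h * indicator {0<..<t} u + G (W u) * indicator {0<..<L} u \<partial>lborel)"
    using t h by (intro nn_integral_mono) (auto simp: indicator_def G_def not_less intro: add_increasing2)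
  also have "\<dots> = h * ennreal t + (\<integral>\<^sup>+u\<in>{0<..<L}. G (W u) \<partial>lborel)"
    using t W_borel[of G L] by (subst nn_integral_add) (auto simp: nn_integral_cmult_indicator)
  finally show ?thesis by (simp add: G_def)
qed

lemma set_nn_integral_powr_eq_avg:
  assumes "set_integrable lebesgue Q (\<lambda>x. w x powr p)"
  shows "(\<integral>\<^sup>+x\<in>Q. ennreal (w x powr p) \<partial>lebesgue) = ennreal (avg Q (\<lambda>x. w x powr p)) * ennreal L"
    "0 \<le> avg Q (\<lambda>x. w x powr p)"
proof -
  have I: "0 \<le> (LINT x:Q|lebesgue. w x powr p)"
    unfolding set_lebesgue_integral_def by (intro integral_nonneg_AE AE_I2) (auto simp: indicator_def)
  have "(\<integral>\<^sup>+x\<in>Q. ennreal (w x powr p) \<partial>lebesgue) = (\<integral>\<^sup>+x. ennreal (indicator Q x * w x powr p) \<partial>lebesgue)"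
    by (intro nn_integral_cong) (auto simp: indicator_def)
  also have "\<dots> = ennreal (LINT x:Q|lebesgue. w x powr p)"
    using assms unfolding set_lebesgue_integral_def set_integrable_def real_scaleR_def
    by (intro nn_integral_eq_integral) (auto simp: indicator_def)
  also have "(LINT x:Q|lebesgue. w x powr p) = avg Q (\<lambda>x. w x powr p) * L"
    using L_pos unfolding avg_def L_def by simp
  also have "ennreal (avg Q (\<lambda>x. w x powr p) * L) = ennreal (avg Q (\<lambda>x. w x powr p)) * ennreal L"
    using I L_pos unfolding avg_def L_def by (intro ennreal_mult) auto
  finally show "(\<integral>\<^sup>+x\<in>Q. ennreal (w x powr p) \<partial>lebesgue) = ennreal (avg Q (\<lambda>x. w x powr p)) * ennreal L" .
  show "0 \<le> avg Q (\<lambda>x. w x powr p)" using I L_pos unfolding avg_def L_def by simp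
qed

lemma avg_nonneg: "0 \<le> avg Q w"
  using phi_nonneg L_pos by (simp add: avg_eq_phi)

text \<open>
  Jensen's inequality for \<open>W\<close> on \<open>(0, t)\<close> holds in reverse, for every \<open>t\<close> and not only for \<open>t = L\<close>,
  where it is the hypothesis on \<open>Q\<close> itself.
\<close>

lemma RHp_rearrangement_bound:
  assumes p: "1 < p" and C: "0 < C"
    and RH: "\<And>P. P \<in> cubes \<Longrightarrow> set_integrable lebesgue P (\<lambda>x. w x powr p) \<and>
      avg P (\<lambda>x. w x powr p) powr (1 / p) \<le> C * avg P w"
    and t: "0 < t" "t \<le> L"
  shows "(\<integral>\<^sup>+u\<in>{0<..<t}. ennreal (W u powr p) \<partial>lborel)
    \<le> ennreal ((2 powr p + (C * 2 ^ CARD('n) * 2) powr p) * (t powr (1 - p) * phi w Q t powr p))"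
proof -
  define lam where "lam = phi w Q t / t"
  have lam: "0 < lam" using phi_pos[OF t] t by (simp add: lam_def)
  define F where "F v = ennreal (max 0 v powr p)" for v
  have F[measurable]: "F \<in> borel_measurable borel" unfolding F_def by measurable
  have "(\<integral>\<^sup>+u\<in>{0<..<t}. ennreal (W u powr p) \<partial>lborel) = (\<integral>\<^sup>+u\<in>{0<..<t}. F (W u) \<partial>lborel)"
    using W_nonneg by (intro nn_integral_cong) (auto simp: F_def indicator_def max_def)
  also have "\<dots> \<le> ennreal ((2 * lam) powr p) * ennreal t +
      (\<integral>\<^sup>+u\<in>{0<..<L}. (if 2 * lam < W u then F (W u) else 0) \<partial>lborel)"
    unfolding F_def using p lam by (intro nn_integral_truncated[OF t] ennreal_leI powr_mono2) auto
  also have "(\<integral>\<^sup>+u\<in>{0<..<L}. (if 2 * lam < W u then F (W u) else 0) \<partial>lborel)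
      \<le> ennreal ((C * (2 ^ CARD('n) * (2 * lam))) powr p) * ennreal t"
    unfolding lam_def
  proof (rule level_set_bound[OF t F])
    fix P assume P: "P \<in> cubes" "P \<subseteq> Q" and avg: "avg P w \<le> 2 ^ CARD('n) * (2 * (phi w Q t / t))"
    interpret P: weight_on_cube w P using w P by unfold_locales
    note int = conjunct1[OF RH[OF P(1)]]
    have "(\<integral>\<^sup>+x\<in>P. F (w x) \<partial>lebesgue) = (\<integral>\<^sup>+x\<in>P. ennreal (w x powr p) \<partial>lebesgue)"
      using P.wQ_pos by (intro nn_integral_cong_AE, eventually_elim)
        (auto simp: F_def indicator_def max_def P.wQ_def)
    also have "\<dots> = ennreal (avg P (\<lambda>x. w x powr p)) * ennreal P.L"
      by (rule P.set_nn_integral_powr_eq_avg[OF int])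
    also have "\<dots> \<le> ennreal ((C * (2 ^ CARD('n) * (2 * (phi w Q t / t)))) powr p) * ennreal P.L"
    proof (intro mult_right_mono ennreal_leI)
      have "avg P (\<lambda>x. w x powr p) = (avg P (\<lambda>x. w x powr p) powr (1 / p)) powr p"
        using p P.set_nn_integral_powr_eq_avg(2)[OF int] by (simp add: powr_powr)
      also have "\<dots> \<le> (C * avg P w) powr p"
        using RH[OF P(1)] p by (intro powr_mono2) auto
      also have "\<dots> \<le> (C * (2 ^ CARD('n) * (2 * (phi w Q t / t)))) powr p"
        using p C avg P.avg_nonneg by (intro powr_mono2 mult_left_mono) auto
      finally show "avg P (\<lambda>x. w x powr p) \<le> (C * (2 ^ CARD('n) * (2 * (phi w Q t / t)))) powr p" .
    qed simp
    finally show "(\<integral>\<^sup>+x\<in>P. F (w x) \<partial>lebesgue)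
        \<le> ennreal ((C * (2 ^ CARD('n) * (2 * (phi w Q t / t)))) powr p) * emeasure lebesgue P"
      by (simp add: P.emeasure_Q)
  qed
  also have "ennreal ((2 * lam) powr p) * ennreal t + ennreal ((C * (2 ^ CARD('n) * (2 * lam))) powr p) * ennreal t
      = ennreal ((2 * lam) powr p * t + (C * (2 ^ CARD('n) * (2 * lam))) powr p * t)"
    using t by (simp add: ennreal_mult ennreal_plus)
  also have "(2 * lam) powr p * t + (C * (2 ^ CARD('n) * (2 * lam))) powr p * t
      = (2 powr p + (C * 2 ^ CARD('n) * 2) powr p) * (lam powr p * t)"
    using lam C by (simp add: powr_mult algebra_simps)
  also have "lam powr p * t = t powr (1 - p) * phi w Q t powr p"
    using t phi_nonneg[of t] by (simp add: lam_def powr_divide powr_diff)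
  finally show ?thesis by (simp add: add_left_mono)
qed

lemma set_integrable_W_powr:
  assumes "s \<le> L" and "(\<integral>\<^sup>+u\<in>{0<..<L}. ennreal (W u powr p) \<partial>lborel) < \<infinity>"
  shows "set_integrable lborel {0<..<s} (\<lambda>u. W u powr p)"
proof -
  have "set_integrable lborel {0<..<L} (\<lambda>u. W u powr p)"
    unfolding set_integrable_def
  proof (rule integrableI_nonneg)
    have [measurable]: "(\<lambda>u. W u * indicator {0<..<L} u) \<in> borel_measurable borel" by (rule W_measurable)
    have "(\<lambda>u. indicator {0<..<L} u *\<^sub>R W u powr p)
        = (\<lambda>u. indicator {0<..<L} u * (W u * indicator {0<..<L} u) powr p)"
      by (auto simp: indicator_def)
    then show "(\<lambda>u. indicator {0<..<L} u *\<^sub>R W u powr p) \<in> borel_measurable lborel" by simp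
    have "(\<integral>\<^sup>+u. ennreal (indicator {0<..<L} u *\<^sub>R W u powr p) \<partial>lborel)
        = (\<integral>\<^sup>+u\<in>{0<..<L}. ennreal (W u powr p) \<partial>lborel)"
      by (intro nn_integral_cong) (auto simp: indicator_def)
    then show "(\<integral>\<^sup>+u. ennreal (indicator {0<..<L} u *\<^sub>R W u powr p) \<partial>lborel) < \<infinity>"
      using assms by simp
  qed (auto simp: indicator_def)
  then show ?thesis by (rule set_integrable_subset) (use assms in auto)
qed

text \<open>
  Up to constants \<open>s\<^bsup>1-p\<^esup> \<phi>(s)\<^sup>p\<close> is \<open>\<Phi>(s) = \<integral>\<^sub>0\<^sup>s W\<^sup>p\<close>, below it by Jensen's inequality and above
  it by the reverse one, so the decay of \<open>\<Phi>\<close> passes to it.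
\<close>

lemma RHp_power_decay:
  assumes p: "1 < p" and K: "0 < K"
    and bound: "\<And>t. 0 < t \<Longrightarrow> t \<le> L \<Longrightarrow> (\<integral>\<^sup>+u\<in>{0<..<t}. ennreal (W u powr p) \<partial>lborel)
      \<le> ennreal (K * (t powr (1 - p) * phi w Q t powr p))"
    and b: "b = min (K powr (- 1 / p)) 1 / 2"
    and st: "0 < s" "s \<le> t" "t \<le> L"
  shows "s powr (1 - p) * phi w Q s powr p \<le> K / (1 - b powr p)
      * (s / t) powr (ln (1 - b powr p) / ln (b powr (p / (p - 1)))) * (t powr (1 - p) * phi w Q t powr p)"
proof -
  define \<epsilon> where "\<epsilon> = b powr (p / (p - 1))"
  define \<eta> where "\<eta> = 1 - b powr p"
  have b01: "0 < b" "b < 1" using K by (auto simp: b)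
  have \<epsilon>: "0 < \<epsilon>" "\<epsilon> < 1"
    using b01 p powr_less_mono2[of "p / (p - 1)" b 1] by (simp_all add: \<epsilon>_def)
  have \<eta>: "0 < \<eta>" "\<eta> < 1"
    using b01 p powr_less_mono2[of p b 1] by (simp_all add: \<eta>_def)
  have int: "set_integrable lborel {0<..<s} (\<lambda>u. W u powr p)" if "s \<le> L" for s
    using bound[of L] L_pos by (intro set_integrable_W_powr[OF that]) (simp add: order_le_less_trans)
  define \<Phi> where "\<Phi> s = (LINT u:{0<..<s}|lborel. W u powr p)" for s
  have \<Phi>_bound: "\<Phi> t \<le> K * (t powr (1 - p) * phi w Q t powr p)" if "0 < t" "t \<le> L" for t
  proof -
    have "ennreal (\<Phi> t) = (\<integral>\<^sup>+u\<in>{0<..<t}. ennreal (W u powr p) \<partial>lborel)"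
      unfolding \<Phi>_def using int[OF that(2)]
      by (subst nn_integral_eq_integral[symmetric, of _ "\<lambda>u. indicator {0<..<t} u *\<^sub>R W u powr p", folded set_lebesgue_integral_def])
        (auto simp: set_integrable_def indicator_def intro!: nn_integral_cong)
    with bound[OF that] have "ennreal (\<Phi> t) \<le> ennreal (K * (t powr (1 - p) * phi w Q t powr p))" by simp
    then show ?thesis using K by (subst (asm) ennreal_le_iff) auto
  qed
  have \<Phi>_split: "\<Phi> t = \<Phi> s + (LINT u:{s..<t}|lborel. W u powr p)" "set_integrable lborel {s..<t} (\<lambda>u. W u powr p)"
    if "0 < s" "s \<le> t" "t \<le> L" for s t
  proof -
    have *: "{0<..<t} = {0<..<s} \<union> {s..<t}" using that by auto
    show "set_integrable lborel {s..<t} (\<lambda>u. W u powr p)"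
      using int[OF that(3)] by (rule set_integrable_subset) (use that in auto)
    then show "\<Phi> t = \<Phi> s + (LINT u:{s..<t}|lborel. W u powr p)"
      unfolding \<Phi>_def * using that int[of s] by (intro set_integral_Un) auto
  qed
  have pos: "0 \<le> (LINT u:S|lborel. W u powr p)" for S
    unfolding set_lebesgue_integral_def by (intro integral_nonneg_AE AE_I2) (auto simp: indicator_def)
  have mono: "\<Phi> s \<le> \<Phi> t" if "0 < s" "s \<le> t" "t \<le> L" for s t
    using \<Phi>_split(1)[OF that] pos[of "{s..<t}"] by simp
  have jensen: "phi w Q s powr p \<le> s powr (p - 1) * \<Phi> s" if "0 < s" "s \<le> L" for s
    unfolding phi_eq \<Phi>_def using that W_nonneg int set_integrable_W
    by (intro jensen_powr[OF p]) auto
  have "\<Phi> s \<le> 1 / \<eta> * (s / t) powr (ln \<eta> / ln \<epsilon>) * \<Phi> t"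
  proof (rule geometric_decay[OF \<epsilon> \<eta> mono _ _ st])
    show "0 \<le> \<Phi> s" for s unfolding \<Phi>_def by (rule pos)
    fix s assume s: "0 < s" "s \<le> L"
    have \<epsilon>s: "0 < \<epsilon> * s" "\<epsilon> * s < s" "\<epsilon> * s \<le> L" "(1 - \<epsilon>) * s = s - \<epsilon> * s"
    proof -
      show "0 < \<epsilon> * s" "\<epsilon> * s < s" using \<epsilon> s by simp_all
      then show "\<epsilon> * s \<le> L" using s by linarith
    qed (simp add: algebra_simps)
    show "\<Phi> (\<epsilon> * s) \<le> \<eta> * \<Phi> s"
      unfolding \<eta>_def b
    proof (rule reverse_jensen_decay[OF p K refl _ s(1), where \<phi> = "phi w Q"])
      show "\<epsilon> = (min (K powr (- 1 / p)) 1 / 2) powr (p / (p - 1))" by (simp add: \<epsilon>_def b)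
      show "\<Phi> (\<epsilon> * s) \<le> \<Phi> s" "phi w Q (\<epsilon> * s) \<le> phi w Q s"
        using \<epsilon>s s by (auto intro!: mono phi_mono)
      show "0 \<le> \<Phi> (\<epsilon> * s)" unfolding \<Phi>_def by (rule pos)
      show "phi w Q (\<epsilon> * s) powr p \<le> (\<epsilon> * s) powr (p - 1) * \<Phi> (\<epsilon> * s)"
        by (rule jensen[OF \<epsilon>s(1,3)])
      have d: "phi w Q s - phi w Q (\<epsilon> * s) = (LINT u:{\<epsilon> * s..<s}|lborel. W u)"
        using phi_split[of "\<epsilon> * s" s] \<epsilon>s s by simp
      have D: "\<Phi> s - \<Phi> (\<epsilon> * s) = (LINT u:{\<epsilon> * s..<s}|lborel. W u powr p)"
        using \<Phi>_split(1)[of "\<epsilon> * s" s] \<epsilon>s s by simp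
      have iW: "set_integrable lborel {\<epsilon> * s..<s} W"
        using set_integrable_W[OF s(2)] by (rule set_integrable_subset) (use \<epsilon>s in auto)
      show "(phi w Q s - phi w Q (\<epsilon> * s)) powr p \<le> ((1 - \<epsilon>) * s) powr (p - 1) * (\<Phi> s - \<Phi> (\<epsilon> * s))"
        unfolding d D \<epsilon>s(4) using \<epsilon>s s W_nonneg \<Phi>_split(2)[of "\<epsilon> * s" s] iW
        by (intro jensen_powr[OF p]) auto
    qed (use phi_nonneg \<Phi>_bound s in auto)
  qed
  also have "\<dots> \<le> 1 / \<eta> * (s / t) powr (ln \<eta> / ln \<epsilon>) * (K * (t powr (1 - p) * phi w Q t powr p))"
    using \<Phi>_bound[of t] st \<eta> by (intro mult_left_mono) auto
  finally have 1: "\<Phi> s \<le> 1 / \<eta> * (s / t) powr (ln \<eta> / ln \<epsilon>) * (K * (t powr (1 - p) * phi w Q t powr p))" .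
  have "s powr (1 - p) * phi w Q s powr p \<le> s powr (1 - p) * (s powr (p - 1) * \<Phi> s)"
    using jensen[of s] st by (intro mult_left_mono) auto
  also have "\<dots> = \<Phi> s" using st by (simp add: powr_diff)
  finally show ?thesis using 1 by (simp add: \<eta>_def \<epsilon>_def mult_ac)
qed

end

section \<open>The endpoint and the converse estimates\<close>

context weight_on_cube
begin

text \<open>
  Here \<open>R = \<kappa> \<phi>(t)/t\<close> exceeds the \<open>L log L\<close> norm of \<open>w\<close> on every cube that \<open>level_set_bound\<close>
  considers. Where \<open>W > M \<phi>(t)/t\<close>, the logarithm \<open>log(e + W/R)\<close> is at least \<open>4\<kappa>\<close> by the choice of
  \<open>M\<close>, so this part of \<open>W\<close> has integral at most \<open>\<phi>(t)/4\<close>; the rest contributes at most \<open>\<phi>(t)/4\<close> over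
  an interval of length \<open>t/(4M)\<close>.
\<close>

lemma LLogL_decay:
  assumes C: "0 < C" and norm: "\<And>P. P \<in> cubes \<Longrightarrow> LLogL_norm P w \<le> ennreal (C * avg P w)"
    and t: "0 < t" "t \<le> L"
    and \<kappa>_def: "\<kappa> = C * 2 ^ (CARD('n) + 2)" and M_def: "M = max 2 (\<kappa> * exp (4 * \<kappa>))"
  shows "phi w Q (1 / (4 * M) * t) \<le> 1 / 2 * phi w Q t"
proof -
  have \<kappa>: "0 < \<kappa>" using C by (simp add: \<kappa>_def)
  have M: "2 \<le> M" "\<kappa> * exp (4 * \<kappa>) \<le> M" by (simp_all add: M_def)
  define lam where "lam = phi w Q t / t"
  have lam: "0 < lam" "phi w Q t = lam * t" using phi_pos[OF t] t by (simp_all add: lam_def)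
  define R where "R = \<kappa> * lam"
  have R: "0 < R" using \<kappa> lam by (simp add: R_def)
  define \<Psi> where "\<Psi> v = v * ln (exp 1 + v)" for v :: real
  have \<Psi>_mono: "\<Psi> u \<le> \<Psi> v" if "0 \<le> u" "u \<le> v" for u v
  proof -
    have e: "1 \<le> exp 1 + u" using that exp_ge_add_one_self[of 1] by linarith
    show ?thesis unfolding \<Psi>_def using that e by (intro mult_mono) auto
  qed
  define F where "F v = ennreal (\<Psi> (\<bar>v\<bar> / R))" for v
  have F[measurable]: "F \<in> borel_measurable borel" unfolding F_def \<Psi>_def by measurable
  have level: "(\<integral>\<^sup>+u\<in>{0<..<L}. (if 2 * lam < W u then F (W u) else 0) \<partial>lborel) \<le> 1 * ennreal t"
    unfolding lam_def
  proof (rule level_set_bound[OF t F])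
    fix P assume P: "P \<in> cubes" "P \<subseteq> Q" and avg: "avg P w \<le> 2 ^ CARD('n) * (2 * (phi w Q t / t))"
    interpret P: weight_on_cube w P using w P by unfold_locales
    have "C * avg P w \<le> C * (2 ^ CARD('n) * (2 * lam))"
      using avg C unfolding lam_def by (intro mult_left_mono) auto
    \<comment> \<open>the extra factor 2 in kappa gives strictness, so that an admissible r below R exists\<close>
    also have "\<dots> < R" using C lam by (simp add: R_def \<kappa>_def)
    finally have "LLogL_norm P w < ennreal R"
      using norm[OF P(1)] R by (intro order_le_less_trans[OF norm[OF P(1)]]) (simp add: ennreal_lessI)
    then obtain r where r: "0 < r" "ennreal r < ennreal R"
      "(\<integral>\<^sup>+y\<in>P. ennreal (\<bar>w y\<bar> / r * ln (exp 1 + \<bar>w y\<bar> / r)) \<partial>lebesgue) / emeasure lebesgue P \<le> 1"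
      unfolding LLogL_norm_def Inf_less_iff by blast
    have "r \<le> R" using r R by (simp add: ennreal_less_iff)
    have "(\<integral>\<^sup>+x\<in>P. F (w x) \<partial>lebesgue)
        \<le> (\<integral>\<^sup>+y\<in>P. ennreal (\<bar>w y\<bar> / r * ln (exp 1 + \<bar>w y\<bar> / r)) \<partial>lebesgue)"
    proof (intro nn_integral_mono mult_right_mono)
      fix x
      have "\<Psi> (\<bar>w x\<bar> / R) \<le> \<Psi> (\<bar>w x\<bar> / r)"
        using r \<open>r \<le> R\<close> R by (intro \<Psi>_mono divide_left_mono) auto
      then show "F (w x) \<le> ennreal (\<bar>w x\<bar> / r * ln (exp 1 + \<bar>w x\<bar> / r))"
        unfolding F_def \<Psi>_def by (rule ennreal_leI)
    qed simp
    also have "\<dots> = (\<integral>\<^sup>+y\<in>P. ennreal (\<bar>w y\<bar> / r * ln (exp 1 + \<bar>w y\<bar> / r)) \<partial>lebesgue)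
        / emeasure lebesgue P * emeasure lebesgue P"
      using P.L_pos by (simp add: P.emeasure_Q ennreal_divide_times ennreal_divide_self)
    also have "\<dots> \<le> 1 * emeasure lebesgue P" by (rule mult_right_mono[OF r(3)]) simp
    finally show "(\<integral>\<^sup>+x\<in>P. F (w x) \<partial>lebesgue) \<le> 1 * emeasure lebesgue P" .
  qed
  define l where "l = ln (exp 1 + M / \<kappa>)"
  have l: "4 * \<kappa> \<le> l"
  proof -
    have "exp (4 * \<kappa>) \<le> M / \<kappa>" using M \<kappa> by (simp add: field_simps)
    also have "\<dots> \<le> exp 1 + M / \<kappa>" by simp
    finally show ?thesis unfolding l_def using \<kappa> M
      by (subst ln_ge_iff) (auto intro: add_pos_nonneg)
  qed
  have "0 < l" using l \<kappa> by simp
  define s where "s = 1 / (4 * M) * t"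
  have s: "0 < s" "s \<le> L" "M * s = t / 4"
  proof -
    show "0 < s" "M * s = t / 4" using t M by (simp_all add: s_def)
    have "s \<le> t" unfolding s_def using t M by (simp add: mult_le_cancel_right2 divide_le_eq)
    then show "s \<le> L" using t by simp
  qed
  have pw: "(if M * lam < v then ennreal v else 0) \<le> ennreal (R / l) * (if 2 * lam < v then F v else 0)" for v
  proof (cases "M * lam < v")
    case True
    have "2 * lam \<le> M * lam" using M lam by (intro mult_right_mono) auto
    then have v: "2 * lam < v" using True by linarith
    moreover have "0 < v" using v lam(1) by linarith
    ultimately have v: "2 * lam < v" "0 < v" by simp_all
    have "M / \<kappa> \<le> v / R" using True \<kappa> lam unfolding R_def by (simp add: field_simps)
    then have "l \<le> ln (exp 1 + v / R)"
      unfolding l_def using \<kappa> M R v by (subst ln_le_cancel_iff) (auto intro!: add_pos_nonneg)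
    then have "v * l \<le> v * ln (exp 1 + v / R)" using v by (intro mult_left_mono) auto
    then have "v \<le> v / l * ln (exp 1 + v / R)" using \<open>0 < l\<close> by (simp add: field_simps)
    also have "\<dots> = R / l * \<Psi> (\<bar>v\<bar> / R)" using R v by (simp add: \<Psi>_def)
    finally have "ennreal v \<le> ennreal (R / l * \<Psi> (\<bar>v\<bar> / R))" by (rule ennreal_leI)
    also have "\<dots> = ennreal (R / l) * F v"
    proof -
      have "0 \<le> \<Psi> (\<bar>v\<bar> / R)" using \<Psi>_mono[of 0 "\<bar>v\<bar> / R"] R by (simp add: \<Psi>_def)
      then show ?thesis unfolding F_def using R \<open>0 < l\<close> by (intro ennreal_mult) auto
    qed
    finally show ?thesis using True v by simp
  qed simp
  define G where "G v = (if 2 * lam < v then F v else 0)" for v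
  have [measurable]: "G \<in> borel_measurable borel" unfolding G_def by measurable
  have "ennreal (phi w Q s) = (\<integral>\<^sup>+u\<in>{0<..<s}. ennreal (W u) \<partial>lborel)"
    by (rule phi_nn[OF s(2), symmetric])
  also have "\<dots> \<le> ennreal (M * lam) * ennreal s +
      (\<integral>\<^sup>+u\<in>{0<..<L}. (if M * lam < W u then ennreal (W u) else 0) \<partial>lborel)"
    by (rule nn_integral_truncated[OF s(1,2)]) (auto intro: ennreal_leI)
  also have "(\<integral>\<^sup>+u\<in>{0<..<L}. (if M * lam < W u then ennreal (W u) else 0) \<partial>lborel)
      \<le> (\<integral>\<^sup>+u. ennreal (R / l) * (G (W u) * indicator {0<..<L} u) \<partial>lborel)"
    unfolding G_def mult.assoc[symmetric] by (intro nn_integral_mono mult_right_mono pw) simp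
  also have "\<dots> = ennreal (R / l) * (\<integral>\<^sup>+u\<in>{0<..<L}. G (W u) \<partial>lborel)"
    by (rule nn_integral_cmult) (rule W_borel, measurable)
  also have "\<dots> \<le> ennreal (R / l) * ennreal t"
    using level unfolding G_def by (intro mult_left_mono) auto
  also have "ennreal (M * lam) * ennreal s + ennreal (R / l) * ennreal t = ennreal (M * lam * s + R / l * t)"
    using M lam s R \<open>0 < l\<close> t by (simp flip: ennreal_mult ennreal_plus)
  finally have "ennreal (phi w Q s) \<le> ennreal (M * lam * s + R / l * t)" by (simp add: add_left_mono)
  then have "phi w Q s \<le> M * lam * s + R / l * t"
    using M lam s R \<open>0 < l\<close> t by (subst (asm) ennreal_le_iff) auto
  also have "M * lam * s = lam * (M * s)" by simp
  also have "R / l * t \<le> lam * (t / 4)"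
  proof -
    have "\<kappa> / l \<le> 1 / 4" using l \<open>0 < l\<close> by (simp add: field_simps)
    then have "\<kappa> / l * (lam * t) \<le> 1 / 4 * (lam * t)" using lam t by (intro mult_right_mono) auto
    then show ?thesis by (simp add: R_def)
  qed
  finally show ?thesis unfolding s(3) by (simp add: s_def lam(2))
qed

text \<open>
  Almost increase with exponent \<open>\<delta>\<close> gives \<open>W(u) \<le> \<phi>(u)/u \<le> C u\<^bsup>\<delta>-1\<^esup> t\<^bsup>-\<delta>\<^esup> \<phi>(t)\<close> for \<open>u < t\<close>, and
  \<open>(\<delta> - 1) p > -1\<close> makes the \<open>p\<close>-th power integrable at 0. On \<open>(t, L)\<close> the bound \<open>W \<le> \<phi>(t)/t\<close>
  suffices, since \<open>t\<close> is a fixed fraction of \<open>L\<close>.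
\<close>

lemma RHp_of_decay:
  assumes p: "1 < p" and \<delta>: "1 - 1 / p < \<delta>" and \<gamma>: "0 < \<gamma>" "\<gamma> < 1"
    and ai: "almost_increasing C (\<gamma> * L) (\<lambda>s. phi w Q s * s powr (- \<delta>))"
    and D_def: "D = (C powr p / (p * \<delta> - p + 1) + 1) * (2 / \<gamma>) powr p"
  shows "set_integrable lebesgue Q (\<lambda>x. w x powr p)"
    "avg Q (\<lambda>x. w x powr p) powr (1 / p) \<le> D powr (1 / p) * avg Q w"
proof -
  define t where "t = \<gamma> * L / 2"
  have t: "0 < t" "t < \<gamma> * L" "t \<le> L" "t < L"
  proof -
    show "0 < t" "t < \<gamma> * L" using \<gamma> L_pos by (simp_all add: t_def)
    moreover have "\<gamma> * L \<le> 1 * L" using \<gamma> L_pos by (intro mult_right_mono) auto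
    ultimately show "t < L" "t \<le> L" by simp_all
  qed
  have C: "1 \<le> C" using ai by (simp add: almost_increasing_def)
  define a where "a = p * \<delta> - p"
  have a: "-1 < a" using \<delta> p by (simp add: a_def field_simps)
  define B where "B = C powr p * (t powr (- \<delta> * p) * phi w Q t powr p)"
  have B: "0 \<le> B" by (simp add: B_def)
  have Wp: "W u powr p \<le> B * u powr a" if u: "0 < u" "u < t" for u
  proof -
    have "u \<in> {0<..<\<gamma> * L}" "t \<in> {0<..<\<gamma> * L}" "u \<le> t" using t u by auto
    then have "phi w Q u * u powr (- \<delta>) \<le> C * (phi w Q t * t powr (- \<delta>))"
      using ai unfolding almost_increasing_def by blast
    moreover have "W u \<le> phi w Q u / u" using W_le_phi[of u] u t by (simp add: field_simps)
    moreover have "phi w Q u / u = phi w Q u * u powr (- \<delta>) * u powr (\<delta> - 1)"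
      using u by (simp add: powr_diff powr_minus field_simps)
    ultimately have "W u \<le> C * (phi w Q t * t powr (- \<delta>)) * u powr (\<delta> - 1)"
      by (smt (verit, best) mult_right_mono powr_ge_zero)
    then have "W u powr p \<le> (C * (phi w Q t * t powr (- \<delta>)) * u powr (\<delta> - 1)) powr p"
      using p W_nonneg u by (intro powr_mono2) auto
    also have "\<dots> = B * u powr ((\<delta> - 1) * p)"
      using C phi_nonneg[of t] t u by (simp add: B_def powr_mult powr_powr)
    also have "(\<delta> - 1) * p = a" by (simp add: a_def algebra_simps)
    finally show ?thesis .
  qed
  define A where "A = avg Q w"
  have A: "0 \<le> A" unfolding A_def by (rule avg_nonneg)
  define X where "X = phi w Q t / t"
  have X: "0 \<le> X" "X \<le> 2 / \<gamma> * A"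
  proof -
    show "0 \<le> X" using phi_nonneg t by (simp add: X_def)
    have "phi w Q t \<le> phi w Q L" using t by (intro phi_mono) auto
    then have "X \<le> phi w Q L / t" unfolding X_def using t by (intro divide_right_mono) auto
    then show "X \<le> 2 / \<gamma> * A" using L_pos by (simp add: t_def A_def avg_eq_phi mult.commute)
  qed
  have int0: "(\<integral>\<^sup>+u\<in>{0..t}. ennreal (u powr a) \<partial>lborel) = ennreal (t powr (a + 1) / (a + 1))"
    using has_integral_powr_from_0[OF a, of t] t
    by (intro nn_integral_has_integral_lebesgue') auto
  have "(\<integral>\<^sup>+x\<in>Q. ennreal (max 0 (wQ x) powr p) \<partial>lebesgue) = (\<integral>\<^sup>+u\<in>{0<..<L}. ennreal (max 0 (W u) powr p) \<partial>lborel)"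
    by (rule nn_integral_W[symmetric]) measurable
  also have "\<dots> \<le> (\<integral>\<^sup>+u. ennreal B * (ennreal (u powr a) * indicator {0..t} u)
      + ennreal (X powr p) * indicator {0<..<L} u \<partial>lborel)"
  proof (rule nn_integral_mono)
    fix u
    consider "u \<in> {0<..<t}" | "u \<in> {t..<L}" | "u \<notin> {0<..<L}" by fastforce
    then show "ennreal (max 0 (W u) powr p) * indicator {0<..<L} u
        \<le> ennreal B * (ennreal (u powr a) * indicator {0..t} u) + ennreal (X powr p) * indicator {0<..<L} u"
    proof cases
      case 1
      then have "ennreal (W u powr p) \<le> ennreal (B * u powr a)" by (intro ennreal_leI Wp) auto
      also have "\<dots> = ennreal B * ennreal (u powr a)" using B by (intro ennreal_mult) auto
      finally show ?thesis using 1 t W_nonneg[of u] by (auto simp: max_def intro: add_increasing2)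
    next
      case 2
      have "W u \<le> W t" using 2 t by (intro W_antimono) auto
      also have "\<dots> \<le> X" using W_le_phi[of t] t by (simp add: X_def field_simps)
      finally have "ennreal (W u powr p) \<le> ennreal (X powr p)"
        using W_nonneg[of u] 2 t p by (intro ennreal_leI powr_mono2) auto
      then show ?thesis using 2 t W_nonneg[of u] by (auto simp: max_def intro: add_increasing)
    qed auto
  qed
  also have "\<dots> = ennreal B * ennreal (t powr (a + 1) / (a + 1)) + ennreal (X powr p) * ennreal L"
    using L_pos by (subst nn_integral_add) (auto simp: nn_integral_cmult_indicator nn_integral_cmult int0)
  also have "\<dots> = ennreal (B * (t powr (a + 1) / (a + 1)) + X powr p * L)"
    using B a L_pos by (simp flip: ennreal_mult ennreal_plus)
  also have "\<dots> \<le> ennreal (D * A powr p * L)"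
  proof (rule ennreal_leI)
    have "B * t powr (a + 1) = C powr p * (X powr p * t)"
      using t phi_nonneg[of t] p
      by (simp add: B_def X_def powr_divide a_def powr_add powr_diff powr_minus field_simps)
    then have "B * (t powr (a + 1) / (a + 1)) = C powr p / (a + 1) * (X powr p * t)" by simp
    also have "\<dots> \<le> C powr p / (a + 1) * (X powr p * L)"
      using a t by (intro mult_left_mono) auto
    finally have "B * (t powr (a + 1) / (a + 1)) + X powr p * L \<le> (C powr p / (a + 1) + 1) * (X powr p * L)"
      by (simp add: algebra_simps)
    also have "\<dots> \<le> (C powr p / (a + 1) + 1) * ((2 / \<gamma> * A) powr p * L)"
      using X p a L_pos by (intro mult_left_mono mult_right_mono powr_mono2) auto
    also have "\<dots> = D * A powr p * L"
      using A \<gamma> by (simp add: D_def a_def powr_mult powr_divide)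
    finally show "B * (t powr (a + 1) / (a + 1)) + X powr p * L \<le> D * A powr p * L" .
  qed
  finally have main: "(\<integral>\<^sup>+x\<in>Q. ennreal (max 0 (wQ x) powr p) \<partial>lebesgue) \<le> ennreal (D * A powr p * L)" .
  have eq: "(\<integral>\<^sup>+x\<in>Q. ennreal (w x powr p) \<partial>lebesgue) = (\<integral>\<^sup>+x\<in>Q. ennreal (max 0 (wQ x) powr p) \<partial>lebesgue)"
    using wQ_pos by (intro nn_integral_cong_AE, eventually_elim) (auto simp: indicator_def max_def wQ_def)
  show int: "set_integrable lebesgue Q (\<lambda>x. w x powr p)"
    unfolding set_integrable_def
  proof (rule integrableI_nonneg)
    have "(\<lambda>x. indicator Q x *\<^sub>R w x powr p) = (\<lambda>x. indicator Q x * wQ x powr p)"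
      by (auto simp: indicator_def wQ_def)
    then show "(\<lambda>x. indicator Q x *\<^sub>R w x powr p) \<in> borel_measurable lebesgue" by simp
    have "(\<integral>\<^sup>+x. ennreal (indicator Q x *\<^sub>R w x powr p) \<partial>lebesgue) = (\<integral>\<^sup>+x\<in>Q. ennreal (w x powr p) \<partial>lebesgue)"
      by (intro nn_integral_cong) (auto simp: indicator_def)
    then show "(\<integral>\<^sup>+x. ennreal (indicator Q x *\<^sub>R w x powr p) \<partial>lebesgue) < \<infinity>"
      using eq main by (simp add: order_le_less_trans)
  qed (auto simp: indicator_def)
  have "ennreal (avg Q (\<lambda>x. w x powr p) * L) \<le> ennreal (D * A powr p * L)"
    using main eq set_nn_integral_powr_eq_avg[OF int] L_pos by (simp add: ennreal_mult)
  moreover have D: "0 \<le> D" using a by (simp add: D_def a_def)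
  ultimately have "avg Q (\<lambda>x. w x powr p) \<le> D * A powr p"
    using L_pos by (subst (asm) ennreal_le_iff) (auto simp: mult_le_cancel_right)
  then have "avg Q (\<lambda>x. w x powr p) powr (1 / p) \<le> (D * A powr p) powr (1 / p)"
    using p set_nn_integral_powr_eq_avg(2)[OF int] by (intro powr_mono2) auto
  also have "\<dots> = D powr (1 / p) * A" using D A p by (simp add: powr_mult powr_powr)
  finally show "avg Q (\<lambda>x. w x powr p) powr (1 / p) \<le> D powr (1 / p) * avg Q w" by (simp add: A_def)
qed

end

text \<open>
  From \<open>e + x \<le> e\<^sup>2 max(1, x)\<close> and \<open>(p - 1) ln x \<le> x\<^bsup>p-1\<^esup>\<close>.
\<close>

lemma mult_ln_le_powr:
  fixes x p :: real
  assumes "1 < p" "0 \<le> x"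
  shows "x * ln (exp 1 + x) \<le> 2 * x + x powr p / (p - 1)"
proof (cases "x \<le> 1")
  case True
  have "exp 1 + x \<le> exp 2"
  proof -
    have "(2::real) \<le> exp 1" using exp_ge_add_one_self[of 1] by simp
    then have "2 * exp 1 \<le> exp 1 * exp (1::real)" by (intro mult_right_mono) auto
    also have "\<dots> = exp 2" by (simp flip: exp_add)
    finally show ?thesis using True \<open>(2::real) \<le> exp 1\<close> by linarith
  qed
  then have "ln (exp 1 + x) \<le> ln (exp 2)"
    using assms by (subst ln_le_cancel_iff) (auto intro: add_pos_nonneg)
  then have "ln (exp 1 + x) \<le> 2" by simp
  then have "x * ln (exp 1 + x) \<le> x * 2" using assms by (intro mult_left_mono) auto
  moreover have "0 \<le> x powr p / (p - 1)" using assms by simp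
  ultimately show ?thesis by simp
next
  case False
  have "exp 1 + x \<le> exp 2 * x"
  proof -
    have "(2::real) \<le> exp 1" using exp_ge_add_one_self[of 1] by simp
    then have "2 * exp 1 \<le> exp 1 * exp (1::real)" by (intro mult_right_mono) auto
    also have "\<dots> = exp 2" by (simp flip: exp_add)
    finally have e: "2 * exp 1 \<le> exp (2::real)" .
    have "exp 1 * 1 \<le> exp 1 * x" "1 * x \<le> exp 1 * x" using False \<open>(2::real) \<le> exp 1\<close>
      by (intro mult_left_mono mult_right_mono; simp)+
    then have "exp 1 + x \<le> 2 * exp 1 * x" by linarith
    also have "\<dots> \<le> exp 2 * x" using e False by (intro mult_right_mono) auto
    finally show ?thesis .
  qed
  then have "ln (exp 1 + x) \<le> ln (exp 2 * x)"
    using False by (subst ln_le_cancel_iff) (auto intro: add_pos_nonneg)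
  also have "\<dots> = 2 + ln x" using False by (simp add: ln_mult)
  also have "ln x \<le> x powr (p - 1) / (p - 1)"
  proof -
    have "(p - 1) * ln x = ln (x powr (p - 1))" using False by (simp add: ln_powr)
    also have "\<dots> \<le> x powr (p - 1) - 1" using False by (intro ln_le_minus_one) simp
    finally have "(p - 1) * ln x \<le> x powr (p - 1)" by simp
    then show ?thesis using assms by (simp add: field_simps)
  qed
  finally have "x * ln (exp 1 + x) \<le> x * (2 + x powr (p - 1) / (p - 1))"
    using assms by (intro mult_left_mono) auto
  also have "\<dots> = 2 * x + x powr p / (p - 1)"
  proof -
    have "x * x powr (p - 1) = x powr p" using False by (simp add: powr_diff)
    then show ?thesis by (simp add: distrib_left)
  qed
  finally show ?thesis .
qed

context weight_on_cube
begin

lemma avg_pos: "0 < avg Q w"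
  using phi_pos[of L] L_pos by (simp add: avg_eq_phi)

text \<open>
  \<open>K\<close> is large enough for each of the two terms of \<open>mult_ln_le_powr\<close>, applied to \<open>w\<close> divided by \<open>K\<close>
  times its average, to have average at most 1/2.
\<close>

lemma LLogL_norm_le:
  assumes p: "1 < p" and C: "0 < C"
    and RH: "set_integrable lebesgue Q (\<lambda>x. w x powr p)" "avg Q (\<lambda>x. w x powr p) powr (1 / p) \<le> C * avg Q w"
    and K_def: "K = 4 + C * (2 / (p - 1)) powr (1 / p)"
  shows "LLogL_norm Q w \<le> ennreal (K * avg Q w)"
proof -
  define A where "A = avg Q w"
  have A: "0 < A" unfolding A_def by (rule avg_pos)
  have K: "4 \<le> K" "C * (2 / (p - 1)) powr (1 / p) \<le> K" using C by (simp_all add: K_def)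
  define r where "r = K * A"
  have r: "0 < r" using K A by (simp add: r_def)
  have [measurable]: "(\<lambda>x. ennreal (w x) * indicator Q x) \<in> borel_measurable lebesgue"
    "(\<lambda>x. ennreal (w x powr p) * indicator Q x) \<in> borel_measurable lebesgue"
  proof -
    have *: "(\<lambda>x. ennreal (w x) * indicator Q x) = (\<lambda>x. ennreal (wQ x) * indicator Q x)"
      "(\<lambda>x. ennreal (w x powr p) * indicator Q x) = (\<lambda>x. ennreal (wQ x powr p) * indicator Q x)"
      by (auto simp: indicator_def wQ_def)
    show "(\<lambda>x. ennreal (w x) * indicator Q x) \<in> borel_measurable lebesgue"
      "(\<lambda>x. ennreal (w x powr p) * indicator Q x) \<in> borel_measurable lebesgue"
      unfolding * by measurable
  qed
  have "avg Q (\<lambda>x. w x powr p) = (avg Q (\<lambda>x. w x powr p) powr (1 / p)) powr p"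
    using p set_nn_integral_powr_eq_avg(2)[OF RH(1)] by (simp add: powr_powr)
  also have "\<dots> \<le> (C * A) powr p" unfolding A_def using RH(2) p by (intro powr_mono2) auto
  finally have avgp: "avg Q (\<lambda>x. w x powr p) \<le> (C * A) powr p" .
  have "(\<integral>\<^sup>+y\<in>Q. ennreal (\<bar>w y\<bar> / r * ln (exp 1 + \<bar>w y\<bar> / r)) \<partial>lebesgue)
      \<le> (\<integral>\<^sup>+y. ennreal (2 / r) * (ennreal (w y) * indicator Q y)
          + ennreal (1 / (r powr p * (p - 1))) * (ennreal (w y powr p) * indicator Q y) \<partial>lebesgue)"
  proof (rule nn_integral_mono_AE)
    show "AE y in lebesgue. ennreal (\<bar>w y\<bar> / r * ln (exp 1 + \<bar>w y\<bar> / r)) * indicator Q y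
        \<le> ennreal (2 / r) * (ennreal (w y) * indicator Q y)
          + ennreal (1 / (r powr p * (p - 1))) * (ennreal (w y powr p) * indicator Q y)"
      using wQ_pos
    proof eventually_elim
      case (elim y)
      show ?case
      proof (cases "y \<in> Q")
        case True
        then have wy: "0 < w y" using elim by (simp add: wQ_def)
        have "\<bar>w y\<bar> / r * ln (exp 1 + \<bar>w y\<bar> / r) \<le> 2 * (\<bar>w y\<bar> / r) + (\<bar>w y\<bar> / r) powr p / (p - 1)"
          using r by (intro mult_ln_le_powr p) simp
        also have "\<dots> = 2 / r * w y + 1 / (r powr p * (p - 1)) * w y powr p"
          using wy r by (simp add: powr_divide)
        finally have "ennreal (\<bar>w y\<bar> / r * ln (exp 1 + \<bar>w y\<bar> / r))
            \<le> ennreal (2 / r * w y + 1 / (r powr p * (p - 1)) * w y powr p)" by (rule ennreal_leI)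
        also have "\<dots> = ennreal (2 / r) * ennreal (w y) + ennreal (1 / (r powr p * (p - 1))) * ennreal (w y powr p)"
          using wy r p by (subst ennreal_plus) (auto simp: ennreal_mult[symmetric])
        finally show ?thesis using True by simp
      qed simp
    qed
  qed
  also have "\<dots> = ennreal (2 / r) * (\<integral>\<^sup>+y\<in>Q. ennreal (w y) \<partial>lebesgue)
      + ennreal (1 / (r powr p * (p - 1))) * (\<integral>\<^sup>+y\<in>Q. ennreal (w y powr p) \<partial>lebesgue)"
    by (subst nn_integral_add) (auto simp: nn_integral_cmult)
  also have "(\<integral>\<^sup>+y\<in>Q. ennreal (w y) \<partial>lebesgue) = ennreal A * ennreal L"
  proof -
    have "(\<integral>\<^sup>+y\<in>Q. ennreal (w y) \<partial>lebesgue) = (\<integral>\<^sup>+y\<in>Q. ennreal (wQ y) \<partial>lebesgue)"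
      by (intro nn_integral_cong) (auto simp: indicator_def wQ_def)
    then show ?thesis using nn_integral_wQ_eq_avg[OF Q] by (simp add: A_def emeasure_Q)
  qed
  also have "(\<integral>\<^sup>+y\<in>Q. ennreal (w y powr p) \<partial>lebesgue) \<le> ennreal ((C * A) powr p) * ennreal L"
    unfolding set_nn_integral_powr_eq_avg(1)[OF RH(1)] using avgp
    by (intro mult_right_mono ennreal_leI) auto
  also have "ennreal (2 / r) * (ennreal A * ennreal L)
      + ennreal (1 / (r powr p * (p - 1))) * (ennreal ((C * A) powr p) * ennreal L)
      = ennreal ((2 / K + (C / K) powr p / (p - 1)) * L)"
  proof -
    have "ennreal (2 / r) * (ennreal A * ennreal L)
      + ennreal (1 / (r powr p * (p - 1))) * (ennreal ((C * A) powr p) * ennreal L)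
      = ennreal (2 / r * (A * L) + 1 / (r powr p * (p - 1)) * ((C * A) powr p * L))"
      using r A L_pos p by (simp flip: ennreal_mult ennreal_plus)
    also have "2 / r * (A * L) + 1 / (r powr p * (p - 1)) * ((C * A) powr p * L)
        = (2 / K + (C / K) powr p / (p - 1)) * L"
    proof -
      have "2 / r * (A * L) = 2 / K * L" using A by (simp add: r_def)
      moreover have "1 / (r powr p * (p - 1)) * ((C * A) powr p * L) = (C / K) powr p / (p - 1) * L"
        using A K C by (simp add: r_def powr_mult powr_divide)
      ultimately show ?thesis by (simp only: distrib_right)
    qed
    finally show ?thesis .
  qed
  also have "\<dots> \<le> ennreal L"
  proof (rule ennreal_leI)
    have "2 / K \<le> 1 / 2" using K by (simp add: field_simps)
    moreover have "(C / K) powr p / (p - 1) \<le> 1 / 2"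
    proof -
      have "(C * (2 / (p - 1)) powr (1 / p)) powr p \<le> K powr p"
        using K C p by (intro powr_mono2) auto
      then have "C powr p * (2 / (p - 1)) \<le> K powr p" using C p by (simp add: powr_mult powr_powr)
      then show ?thesis using K C p by (simp add: powr_divide field_simps)
    qed
    ultimately have "2 / K + (C / K) powr p / (p - 1) \<le> 1" by linarith
    then have "(2 / K + (C / K) powr p / (p - 1)) * L \<le> 1 * L" using L_pos by (intro mult_right_mono) auto
    then show "(2 / K + (C / K) powr p / (p - 1)) * L \<le> L" by simp
  qed
  finally have "(\<integral>\<^sup>+y\<in>Q. ennreal (\<bar>w y\<bar> / r * ln (exp 1 + \<bar>w y\<bar> / r)) \<partial>lebesgue) \<le> ennreal L"
    by (simp add: add_left_mono mult_left_mono)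
  then have "(\<integral>\<^sup>+y\<in>Q. ennreal (\<bar>w y\<bar> / r * ln (exp 1 + \<bar>w y\<bar> / r)) \<partial>lebesgue) / emeasure lebesgue Q \<le> 1"
    unfolding emeasure_Q using L_pos by (intro divide_le_posI_ennreal) auto
  then show ?thesis
    unfolding LLogL_norm_def using r by (intro Inf_lower imageI) (simp add: r_def A_def)
qed

end

section \<open>The index\<close>

text \<open>
  The supremum of the index is used only through these two facts. The exponents are nonnegative, so
  no information is lost by taking it in the extended nonnegative reals.
\<close>

lemma less_indD:
  assumes "ennreal c < ind \<Phi>" "0 \<le> c"
  obtains \<delta> \<gamma> C where "c < \<delta>" "0 < \<gamma>" "\<gamma> < 1"
    "\<And>Q. Q \<in> cubes \<Longrightarrow> almost_increasing C (\<gamma> * measure lebesgue Q) (\<lambda>s. \<Phi> Q s * s powr (- \<delta>))"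
proof -
  obtain \<delta> \<gamma> C where *: "ennreal c < ennreal \<delta>" "\<gamma> \<in> {0<..<1}"
    "\<forall>Q\<in>cubes. almost_increasing C (\<gamma> * measure lebesgue Q) (\<lambda>s. \<Phi> Q s * s powr (- \<delta>))"
    using assms(1) unfolding ind_def less_Sup_iff by blast
  moreover have "c < \<delta>" using *(1) assms(2) by (simp add: ennreal_less_iff)
  ultimately show thesis by (intro that[of \<delta> \<gamma> C]) auto
qed

lemma ind_upper:
  assumes "0 \<le> \<delta>" "0 < \<gamma>" "\<gamma> < 1"
    "\<And>Q. Q \<in> cubes \<Longrightarrow> almost_increasing C (\<gamma> * measure lebesgue Q) (\<lambda>s. \<Phi> Q s * s powr (- \<delta>))"
  shows "ennreal \<delta> \<le> ind \<Phi>"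
  unfolding ind_def using assms by (intro Sup_upper imageI CollectI conjI bexI[of _ \<gamma>] exI[of _ C]) auto

lemma almost_increasing_of_power_bound:
  assumes K: "1 \<le> K" and nonneg: "\<And>s. 0 < s \<Longrightarrow> s < l \<Longrightarrow> 0 \<le> g s"
    and bound: "\<And>s t. 0 < s \<Longrightarrow> s \<le> t \<Longrightarrow> t < l \<Longrightarrow> g s \<le> K * (s / t) powr \<delta> * g t"
  shows "almost_increasing K l (\<lambda>s. g s * s powr (- \<delta>))"
  unfolding almost_increasing_def
proof (intro conjI ballI impI K)
  fix s t assume st: "s \<in> {0<..<l}" "t \<in> {0<..<l}" "s \<le> t"
  have "g s * s powr (- \<delta>) \<le> (K * (s / t) powr \<delta> * g t) * s powr (- \<delta>)"
    using bound[of s t] st by (intro mult_right_mono) auto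
  also have "\<dots> = K * (g t * t powr (- \<delta>))"
    using st by (simp add: powr_divide powr_minus field_simps)
  finally show "g s * s powr (- \<delta>) \<le> K * (g t * t powr (- \<delta>))" .
qed (use nonneg in auto)

lemma (in weight_on_cube) le_L: "t < 1 / 2 * measure lebesgue Q \<Longrightarrow> t \<le> L"
  using L_pos unfolding L_def by linarith

lemma RHp_imp_ind_pos:
  fixes w :: "real ^ 'n \<Rightarrow> real"
  assumes p: "1 < p" "1 / p' = 1 - 1 / p" and w: "w \<in> RHp p"
  shows "0 < ind (phi_wt w (1 / p') p)"
proof -
  obtain C where C: "0 < C" "\<And>P. P \<in> cubes \<Longrightarrow> set_integrable lebesgue P (\<lambda>x. w x powr p) \<and>
      avg P (\<lambda>x. w x powr p) powr (1 / p) \<le> C * avg P w" and ww: "w \<in> weights"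
    using w unfolding RHp_def by blast
  define K where "K = 2 powr p + (C * 2 ^ CARD('n) * 2) powr p"
  have K: "0 < K" by (simp add: K_def add_pos_nonneg)
  define b where "b = min (K powr (- 1 / p)) 1 / 2"
  have b: "0 < b" "b < 1" using K by (auto simp: b_def)
  have bp: "0 < b powr p" "b powr p < 1" "b powr (p / (p - 1)) < 1"
    using b p(1) powr_less_mono2[of p b 1] powr_less_mono2[of "p / (p - 1)" b 1] by simp_all
  define \<delta> where "\<delta> = ln (1 - b powr p) / ln (b powr (p / (p - 1)))"
  have \<delta>: "0 < \<delta>"
    unfolding \<delta>_def using bp b by (intro divide_neg_neg ln_less_zero) auto
  define K' where "K' = max 1 (K / (1 - b powr p))"
  have "ennreal \<delta> \<le> ind (phi_wt w (1 / p') p)"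
  proof (rule ind_upper)
    fix Q :: "(real ^ 'n) set" assume Q: "Q \<in> cubes"
    interpret weight_on_cube w Q using ww Q by unfold_locales
    have wt: "phi_wt w (1 / p') p Q s = s powr (1 - p) * phi w Q s powr p" if "0 < s" for s
    proof -
      have "- (1 / p') * p = 1 - p" unfolding p(2) using p(1) by (simp add: field_simps)
      then show ?thesis
        using that phi_nonneg[of s] unfolding phi_wt_def by (simp add: powr_mult powr_powr)
    qed
    show "almost_increasing K' (1 / 2 * measure lebesgue Q) (\<lambda>s. phi_wt w (1 / p') p Q s * s powr (- \<delta>))"
    proof (rule almost_increasing_of_power_bound)
      fix s t assume st: "0 < s" "s \<le> t" "t < 1 / 2 * measure lebesgue Q"
      then have tL: "t \<le> L" by (intro le_L)
      have "phi_wt w (1 / p') p Q s \<le> K / (1 - b powr p) * (s / t) powr \<delta> * phi_wt w (1 / p') p Q t"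
        using RHp_power_decay[OF p(1) K RHp_rearrangement_bound[OF p(1) C, folded K_def] b_def st(1,2) tL] st
        by (simp add: wt \<delta>_def)
      also have "\<dots> \<le> K' * (s / t) powr \<delta> * phi_wt w (1 / p') p Q t"
        by (intro mult_right_mono) (auto simp: K'_def phi_wt_def)
      finally show "phi_wt w (1 / p') p Q s \<le> K' * (s / t) powr \<delta> * phi_wt w (1 / p') p Q t" .
    qed (auto simp: K'_def phi_wt_def)
  qed (use \<delta> in auto)
  moreover have "0 < ennreal \<delta>" using \<delta> by simp
  ultimately show ?thesis by (rule order_less_le_trans[rotated])
qed

text \<open>
  The function \<open>(s\<^bsup>-1/p'\<^esup> \<phi>(s))\<^sup>p s\<^bsup>-\<delta>\<^esup>\<close> is the \<open>p\<close>-th power of \<open>\<phi>(s) s\<^bsup>-(1/p' + \<delta>/p)\<^esup>\<close>, so an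
  exponent \<open>\<delta>\<close> of the former yields the exponent \<open>1/p' + \<delta>/p\<close> of the latter.
\<close>

lemma ind_phi_wt_pos_imp:
  fixes w :: "real ^ 'n \<Rightarrow> real"
  assumes p: "1 < p" "1 / p' = 1 - 1 / p" and w: "w \<in> weights" and ind: "0 < ind (phi_wt w (1 / p') p)"
  shows "ennreal (1 / p') < ind (phi w)"
proof -
  have p': "0 < 1 / p'" using p by simp
  obtain \<delta> \<gamma> C where *: "0 < \<delta>" "0 < \<gamma>" "\<gamma> < 1"
    "\<And>Q. Q \<in> cubes \<Longrightarrow> almost_increasing C (\<gamma> * measure lebesgue Q) (\<lambda>s. phi_wt w (1 / p') p Q s * s powr (- \<delta>))"
    using less_indD[of 0 "phi_wt w (1 / p') p"] ind by auto
  have \<delta>: "0 < \<delta> / p" using * p by simp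
  have pos: "0 < 1 / p' + \<delta> / p" using p' \<delta> by (rule add_pos_pos)
  have "ennreal (1 / p' + \<delta> / p) \<le> ind (phi w)"
  proof (rule ind_upper)
    fix Q :: "(real ^ 'n) set" assume Q: "Q \<in> cubes"
    interpret weight_on_cube w Q using w Q by unfold_locales
    have root: "(phi_wt w (1 / p') p Q s * s powr (- \<delta>)) powr (1 / p) = phi w Q s * s powr (- (1 / p' + \<delta> / p))"
      if "0 < s" for s
    proof -
      have "phi_wt w (1 / p') p Q s powr (1 / p) = s powr (- (1 / p')) * phi w Q s"
        using p phi_nonneg[of s] unfolding phi_wt_def by (simp add: powr_powr)
      then have "(phi_wt w (1 / p') p Q s * s powr (- \<delta>)) powr (1 / p)
          = phi w Q s * (s powr (- (1 / p')) * s powr (- \<delta> / p))"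
        using that by (simp add: powr_mult powr_powr phi_wt_def)
      also have "s powr (- (1 / p')) * s powr (- \<delta> / p) = s powr (- (1 / p' + \<delta> / p))"
        by (simp flip: powr_add)
      finally show ?thesis .
    qed
    note ai = *(4)[OF Q, unfolded almost_increasing_def]
    show "almost_increasing (C powr (1 / p)) (\<gamma> * measure lebesgue Q) (\<lambda>s. phi w Q s * s powr (- (1 / p' + \<delta> / p)))"
      unfolding almost_increasing_def
    proof (intro conjI ballI impI)
      show "1 \<le> C powr (1 / p)" using ai p by (intro ge_one_powr_ge_zero) auto
      show "0 \<le> phi w Q s * s powr (- (1 / p' + \<delta> / p))" for s using phi_nonneg by simp
      fix s t assume st: "s \<in> {0<..<\<gamma> * measure lebesgue Q}" "t \<in> {0<..<\<gamma> * measure lebesgue Q}" "s \<le> t"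
      then have "(phi_wt w (1 / p') p Q s * s powr (- \<delta>)) powr (1 / p)
          \<le> (C * (phi_wt w (1 / p') p Q t * t powr (- \<delta>))) powr (1 / p)"
        using ai p by (intro powr_mono2) auto
      also have "\<dots> = C powr (1 / p) * (phi_wt w (1 / p') p Q t * t powr (- \<delta>)) powr (1 / p)"
        by (rule powr_mult)
      finally show "phi w Q s * s powr (- (1 / p' + \<delta> / p))
          \<le> C powr (1 / p) * (phi w Q t * t powr (- (1 / p' + \<delta> / p)))"
        using root st by simp
    qed
  qed (use *(2,3) pos in auto)
  moreover have "ennreal (1 / p') < ennreal (1 / p' + \<delta> / p)"
    using pos \<delta> by (intro ennreal_lessI) auto
  ultimately show ?thesis by (rule order_less_le_trans[rotated])
qed

lemma ind_gt_imp_RHp: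
  fixes w :: "real ^ 'n \<Rightarrow> real"
  assumes p: "1 < p" and w: "w \<in> weights" and ind: "ennreal (1 - 1 / p) < ind (phi w)"
  shows "w \<in> RHp p"
proof -
  obtain \<delta> \<gamma> C where *: "1 - 1 / p < \<delta>" "0 < \<gamma>" "\<gamma> < 1"
    "\<And>Q. Q \<in> cubes \<Longrightarrow> almost_increasing C (\<gamma> * measure lebesgue Q) (\<lambda>s. phi w Q s * s powr (- \<delta>))"
    using less_indD[OF ind] p by auto
  define D where "D = (C powr p / (p * \<delta> - p + 1) + 1) * (2 / \<gamma>) powr p"
  have "set_integrable lebesgue Q (\<lambda>x. w x powr p) \<and>
      avg Q (\<lambda>x. w x powr p) powr (1 / p) \<le> D powr (1 / p) * avg Q w" if Q: "Q \<in> cubes" for Q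
  proof -
    interpret weight_on_cube w Q using w Q by unfold_locales
    show ?thesis using RHp_of_decay[OF p *(1,2,3) *(4)[OF Q, folded L_def] D_def] by blast
  qed
  moreover have "0 < D"
  proof -
    have "0 < p * \<delta> - p + 1" using *(1) p by (simp add: field_simps)
    then show ?thesis using * by (simp add: D_def add_nonneg_pos)
  qed
  then have "0 < D powr (1 / p)" by simp
  ultimately show ?thesis using w unfolding RHp_def by blast
qed

lemma ind_pos_imp_RH:
  fixes w :: "real ^ 'n \<Rightarrow> real"
  assumes w: "w \<in> weights" and ind: "0 < ind (phi w)"
  shows "w \<in> RH"
proof -
  obtain \<delta> \<gamma> C where *: "0 < \<delta>" "0 < \<gamma>" "\<gamma> < 1"
    "\<And>Q. Q \<in> cubes \<Longrightarrow> almost_increasing C (\<gamma> * measure lebesgue Q) (\<lambda>s. phi w Q s * s powr (- \<delta>))"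
    using less_indD[of 0 "phi w"] ind by auto
  \<comment> \<open>alpha is 1/p' for the exponent p = 1 / (1 - alpha)\<close>
  define \<alpha> where "\<alpha> = min \<delta> 1 / 2"
  have \<alpha>: "0 < \<alpha>" "\<alpha> < 1" "\<alpha> < \<delta>" using *(1) by (auto simp: \<alpha>_def)
  have "ennreal \<delta> \<le> ind (phi w)" using * by (intro ind_upper) auto
  moreover have "ennreal \<alpha> < ennreal \<delta>" using \<alpha> by (intro ennreal_lessI) auto
  ultimately have "ennreal (1 - 1 / (1 / (1 - \<alpha>))) < ind (phi w)" by simp
  moreover have "1 < 1 / (1 - \<alpha>)" using \<alpha> by simp
  ultimately have "w \<in> RHp (1 / (1 - \<alpha>))" using w by (intro ind_gt_imp_RHp)
  then show ?thesis using \<open>1 < 1 / (1 - \<alpha>)\<close> by (auto simp: RH_def)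
qed

lemma RH_imp_ind_pos:
  fixes w :: "real ^ 'n \<Rightarrow> real"
  assumes "w \<in> RH"
  shows "0 < ind (phi w)"
proof -
  obtain p where p: "1 < p" "w \<in> RHp p" using assms by (auto simp: RH_def)
  define p' where "p' = 1 / (1 - 1 / p)"
  have p': "1 / p' = 1 - 1 / p" by (simp add: p'_def)
  have "ennreal (1 / p') < ind (phi w)"
    using RHp_imp_ind_pos[OF p(1) p' p(2)] p by (intro ind_phi_wt_pos_imp[OF p(1) p']) (auto simp: RHp_def)
  then show ?thesis by (rule order_le_less_trans[rotated]) simp
qed

lemma RH_subset_RH_LLogL: "RH \<subseteq> (RH_LLogL :: (real ^ 'n \<Rightarrow> real) set)"
proof
  fix w :: "real ^ 'n \<Rightarrow> real" assume "w \<in> RH"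
  then obtain p where p: "1 < p" "w \<in> RHp p" by (auto simp: RH_def)
  then obtain C where C: "0 < C" "\<And>P. P \<in> cubes \<Longrightarrow> set_integrable lebesgue P (\<lambda>x. w x powr p) \<and>
      avg P (\<lambda>x. w x powr p) powr (1 / p) \<le> C * avg P w" and w: "w \<in> weights"
    unfolding RHp_def by blast
  define K where "K = 4 + C * (2 / (p - 1)) powr (1 / p)"
  have "LLogL_norm Q w \<le> ennreal (K * avg Q w)" if Q: "Q \<in> cubes" for Q
  proof -
    interpret weight_on_cube w Q using w Q by unfold_locales
    show ?thesis using C(2)[OF Q] by (intro LLogL_norm_le[OF p(1) C(1) _ _ K_def]) auto
  qed
  moreover have "0 < K" using C by (simp add: K_def add_pos_nonneg)
  ultimately show "w \<in> RH_LLogL" using w unfolding RH_LLogL_def by blast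
qed

lemma RH_LLogL_imp_ind_pos:
  fixes w :: "real ^ 'n \<Rightarrow> real"
  assumes "w \<in> RH_LLogL"
  shows "0 < ind (phi w)"
proof -
  obtain C where C: "0 < C" "\<And>P. P \<in> cubes \<Longrightarrow> LLogL_norm P w \<le> ennreal (C * avg P w)"
    and w: "w \<in> weights"
    using assms unfolding RH_LLogL_def by blast
  define \<kappa> where "\<kappa> = C * 2 ^ (CARD('n) + 2)"
  define M where "M = max 2 (\<kappa> * exp (4 * \<kappa>))"
  define \<theta> where "\<theta> = 1 / (4 * M)"
  have "2 \<le> M" by (simp add: M_def)
  then have \<theta>: "0 < \<theta>" "\<theta> < 1" by (simp_all add: \<theta>_def)
  define \<delta> where "\<delta> = ln (1 / 2) / ln \<theta>"
  have \<delta>: "0 < \<delta>" unfolding \<delta>_def using \<theta> by (intro divide_neg_neg) auto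
  have "ennreal \<delta> \<le> ind (phi w)"
  proof (rule ind_upper)
    fix Q :: "(real ^ 'n) set" assume Q: "Q \<in> cubes"
    interpret weight_on_cube w Q using w Q by unfold_locales
    show "almost_increasing 2 (1 / 2 * measure lebesgue Q) (\<lambda>s. phi w Q s * s powr (- \<delta>))"
    proof (rule almost_increasing_of_power_bound)
      fix s t assume st: "0 < s" "s \<le> t" "t < 1 / 2 * measure lebesgue Q"
      then have tL: "t \<le> L" by (intro le_L)
      have "phi w Q s \<le> 1 / (1 / 2) * (s / t) powr (ln (1 / 2) / ln \<theta>) * phi w Q t"
        using LLogL_decay[OF C _ _ \<kappa>_def M_def, folded \<theta>_def] phi_nonneg phi_mono
        by (intro geometric_decay[OF \<theta> _ _ _ _ _ st(1,2) tL]) auto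
      then show "phi w Q s \<le> 2 * (s / t) powr \<delta> * phi w Q t" by (simp add: \<delta>_def)
    qed (auto simp: phi_nonneg)
  qed (use \<delta> in auto)
  moreover have "0 < ennreal \<delta>" using \<delta> by simp
  ultimately show ?thesis by (rule order_less_le_trans[rotated])
qed

theorem theorem6:
  shows "(\<forall>p p' :: real. 1 < p \<and> 1 / p' = 1 - 1 / p \<longrightarrow>
            (RHp p :: (real ^ 'n \<Rightarrow> real) set) = {w \<in> weights. ind (phi_wt w (1 / p') p) > 0} \<and>
            (RHp p :: (real ^ 'n \<Rightarrow> real) set) = {w \<in> weights. ind (phi w) > ennreal (1 / p')})
       \<and> (RH :: (real ^ 'n \<Rightarrow> real) set) = {w \<in> weights. ind (phi w) > 0}
       \<and> (RH :: (real ^ 'n \<Rightarrow> real) set) = RH_LLogL"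
proof (intro conjI allI impI)
  fix p p' :: real assume "1 < p \<and> 1 / p' = 1 - 1 / p"
  then have p: "1 < p" "1 / p' = 1 - 1 / p" by auto
  have sub: "w \<in> weights" if "w \<in> RHp p" for w :: "real ^ 'n \<Rightarrow> real"
    using that by (simp add: RHp_def)
  have converse: "w \<in> RHp p" if "w \<in> weights" "ennreal (1 / p') < ind (phi w)" for w :: "real ^ 'n \<Rightarrow> real"
    using ind_gt_imp_RHp[OF p(1) that(1)] that(2) p(2) by simp
  show "(RHp p :: (real ^ 'n \<Rightarrow> real) set) = {w \<in> weights. ind (phi_wt w (1 / p') p) > 0}"
    using sub converse RHp_imp_ind_pos[OF p] ind_phi_wt_pos_imp[OF p] by blast
  show "(RHp p :: (real ^ 'n \<Rightarrow> real) set) = {w \<in> weights. ind (phi w) > ennreal (1 / p')}"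
    using sub converse RHp_imp_ind_pos[OF p] ind_phi_wt_pos_imp[OF p] by blast
next
  have "w \<in> weights" if "w \<in> RH" for w :: "real ^ 'n \<Rightarrow> real"
    using that by (auto simp: RH_def RHp_def)
  then show "(RH :: (real ^ 'n \<Rightarrow> real) set) = {w \<in> weights. ind (phi w) > 0}"
    using ind_pos_imp_RH RH_imp_ind_pos by blast
next
  have "w \<in> RH" if "w \<in> RH_LLogL" for w :: "real ^ 'n \<Rightarrow> real"
    using RH_LLogL_imp_ind_pos[OF that] that by (intro ind_pos_imp_RH) (auto simp: RH_LLogL_def)
  then show "(RH :: (real ^ 'n \<Rightarrow> real) set) = RH_LLogL"
    using RH_subset_RH_LLogL by blast
qed

end
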